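(* Let $V$ be an $n$-dimensional $K$-vector space with a linear $R$-structure $V_R$, and let $E,F\subseteq V$ be $K$-subspaces of dimensions $k$ and $\ell$, respectively, such that $k\le\ell$ and $k+\ell\le n$. Then there exist $(x_1,\ldots,x_k)\in\overline{\mathbb{N}}{}^k_o$ and an $R$-basis $$e_1,\ldots,e_\ell,\;f_1,\ldots,f_k,\;g_1,\ldots,g_{n-k-\ell}$$ of $V_R$ such that $F=\mathrm{span}_K\{e_1,\ldots,e_\ell\}$ and $$E=\mathrm{span}_K\{e_1+\varpi^{x_1}f_1,\ldots,e_k+\varpi^{x_k}f_k\}.$$ The pair $(E,F)$ has the position vector $x=(x_1,\ldots,x_k)$.
   Context: $K$ is a nonarchimedean local field of characteristic zero with valuation ring $R$, uniformizer $\varpi$, residue field of cardinality $q$, $\varepsilon=q^{-1}$, and $|\varpi|=\varepsilon$. $\overline{\mathbb{N}}=\mathbb{N}\cup\{\infty\}$ (with $0\in\mathbb N$), $\overline{\mathbb{N}}{}^k_o=\{x\in\overline{\mathbb{N}}{}^k\mid x_1\le\cdots\le x_k\}$, with $\varpi^\infty=0$, $\varepsilon^\infty=0$. A linear $R$-structure on a finite-dimensional $K$-space $V$ is a finitely generated $R$-submodule $V_R$ spanning $V$ (a full lattice). Subspaces $U\subseteq V$ carry $U\cap V_R$, products the product lattice. The singular values $\sigma_1\ge\sigma_2\ge\cdots\ge0$ of a $K$-linear map between spaces with linear $R$-structures are the absolute values of the diagonal entries of the Smith normal form over $R$ of its matrix with respect to $R$-bases of the lattices. For $E,F\subseteq V$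 of dimensions $k\le\ell$ with $k+\ell\le n$, the decreasing list of the $k+\ell$ singular values of the addition map $E\times F\to V$, $(e,f)\mapsto e+f$, starts with $\ell$ ones; its last $k$ entries are written $\varepsilon^{x_1}\ge\cdots\ge\varepsilon^{x_k}$, and $(x_1,\ldots,x_k)\in\overline{\mathbb{N}}{}^k_o$ is called the position vector of $(E,F)$. *)

theory Defs
  imports
    "Jordan_Normal_Form.Matrix"
    "HOL-Analysis.Product_Vector"
    "HOL-Library.Extended_Nat"
begin

section \<open>Nonarchimedean local fields of characteristic zero\<close>

definition valuation_ring :: "('k::field \<Rightarrow> real) \<Rightarrow> 'k set"
  where "valuation_ring absv = {a. absv a \<le> 1}"

definition maximal_ideal :: "('k::field \<Rightarrow> real) \<Rightarrow> 'k set"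
  where "maximal_ideal absv = {a. absv a < 1}"

definition residue_field :: "('k::field \<Rightarrow> real) \<Rightarrow> 'k set set"
  where "residue_field absv = valuation_ring absv //
    {(a, b). a \<in> valuation_ring absv \<and> b \<in> valuation_ring absv \<and> a - b \<in> maximal_ideal absv}"

definition epsilon :: "('k::field \<Rightarrow> real) \<Rightarrow> real"
  where "epsilon absv = 1 / real (card (residue_field absv))"

text \<open>The condition \<open>uniformizer\<close> says that the maximal ideal is principal and nonzero, which makes
  the valuation discrete and nontrivial.\<close>

locale nonarch_local_field =
  fixes absv :: "'k::field_char_0 \<Rightarrow> real" and \<pi> :: 'k
  assumes absv_nonneg: "absv a \<ge> 0"
    and absv_eq_0_iff: "absv a = 0 \<longleftrightarrow> a = 0"
    and absv_mult: "absv (a * b) = absv a * absv b"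
    and absv_ultrametric: "absv (a + b) \<le> max (absv a) (absv b)"
    and absv_complete:
      "(\<forall>e>0. \<exists>N. \<forall>m\<ge>N. \<forall>n\<ge>N. absv (X m - X n) < e) \<Longrightarrow>
        \<exists>a. (\<lambda>n::nat. absv (X n - a)) \<longlonglongrightarrow> 0"
    and finite_residue_field: "finite (residue_field absv)"
    and uniformizer: "\<pi> \<noteq> 0" "maximal_ideal absv = (\<lambda>a. \<pi> * a) ` valuation_ring absv"
    and absv_uniformizer: "absv \<pi> = epsilon absv"


section \<open>Linear structures over the valuation ring\<close>

definition R_submodule ::
    "('k::field \<Rightarrow> real) \<Rightarrow> ('k \<Rightarrow> 'v::ab_group_add \<Rightarrow> 'v) \<Rightarrow> 'v set \<Rightarrow> bool"
  where "R_submodule absv scl M \<longleftrightarrow>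
    0 \<in> M \<and> (\<forall>x\<in>M. \<forall>y\<in>M. x + y \<in> M) \<and> (\<forall>a\<in>valuation_ring absv. \<forall>x\<in>M. scl a x \<in> M)"

definition R_finitely_generated ::
    "('k::field \<Rightarrow> real) \<Rightarrow> ('k \<Rightarrow> 'v::ab_group_add \<Rightarrow> 'v) \<Rightarrow> 'v set \<Rightarrow> bool"
  where "R_finitely_generated absv scl M \<longleftrightarrow>
    (\<exists>S. finite S \<and> S \<subseteq> M \<and>
      (\<forall>x\<in>M. \<exists>c. (\<forall>s\<in>S. c s \<in> valuation_ring absv) \<and> x = (\<Sum>s\<in>S. scl (c s) s)))"

definition linear_R_structure ::
    "('k::field \<Rightarrow> real) \<Rightarrow> ('k \<Rightarrow> 'v::ab_group_add \<Rightarrow> 'v) \<Rightarrow> 'v set \<Rightarrow> bool"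
  where "linear_R_structure absv scl M \<longleftrightarrow>
    R_submodule absv scl M \<and> R_finitely_generated absv scl M \<and>
    module.span scl M = UNIV"

text \<open>Bases are ordered, hence lists of vectors.\<close>

definition R_basis ::
    "('k::field \<Rightarrow> real) \<Rightarrow> ('k \<Rightarrow> 'v::ab_group_add \<Rightarrow> 'v) \<Rightarrow> 'v set \<Rightarrow> 'v list \<Rightarrow> bool"
  where "R_basis absv scl M bs \<longleftrightarrow>
    set bs \<subseteq> M \<and>
    (\<forall>x\<in>M. \<exists>c. (\<forall>i<length bs. c i \<in> valuation_ring absv) \<and>
      x = (\<Sum>i<length bs. scl (c i) (bs ! i))) \<and>
    (\<forall>c. (\<forall>i<length bs. c i \<in> valuation_ring absv) \<longrightarrow>
      (\<Sum>i<length bs. scl (c i) (bs ! i)) = 0 \<longrightarrow> (\<forall>i<length bs. c i = 0))"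


section \<open>Smith normal form and singular values\<close>

text \<open>The columns of \<open>A\<close> are the coordinates, with respect to \<open>cs\<close>, of the images of \<open>bs\<close>.\<close>

definition matrix_of ::
    "('k::field \<Rightarrow> 'w::ab_group_add \<Rightarrow> 'w) \<Rightarrow> ('v \<Rightarrow> 'w) \<Rightarrow> 'v list \<Rightarrow> 'w list \<Rightarrow> 'k mat \<Rightarrow> bool"
  where "matrix_of scl T bs cs A \<longleftrightarrow>
    A \<in> carrier_mat (length cs) (length bs) \<and>
    (\<forall>j<length bs. T (bs ! j) = (\<Sum>i<length cs. scl (A $$ (i, j)) (cs ! i)))"

definition GL_R :: "('k::field \<Rightarrow> real) \<Rightarrow> nat \<Rightarrow> 'k mat set"
  where "GL_R absv m = {P \<in> carrier_mat m m. elements_mat P \<subseteq> valuation_ring absv \<and>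
    (\<exists>Q \<in> carrier_mat m m. elements_mat Q \<subseteq> valuation_ring absv \<and>
      inverts_mat P Q \<and> inverts_mat Q P)}"

text \<open>The entries of \<open>A\<close> may lie outside \<open>R\<close>; divisibility of the diagonal entries means that
  each is an \<open>R\<close>-multiple of its predecessor.\<close>

definition smith_normal_form :: "('k::field \<Rightarrow> real) \<Rightarrow> 'k mat \<Rightarrow> 'k mat \<Rightarrow> bool"
  where "smith_normal_form absv A D \<longleftrightarrow>
    (\<exists>P \<in> GL_R absv (dim_row A). \<exists>Q \<in> GL_R absv (dim_col A). D = P * A * Q) \<and>
    diagonal_mat D \<and>
    (\<forall>i. Suc i < min (dim_row D) (dim_col D) \<longrightarrow>
      (\<exists>r \<in> valuation_ring absv. D $$ (Suc i, Suc i) = r * D $$ (i, i)))"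

text \<open>The singular values of \<open>T\<close>, seen as a map from the \<open>K\<close>-span of the lattice \<open>M\<close> to the
  \<open>K\<close>-span of the lattice \<open>N\<close>. They depend neither on the bases nor on the Smith normal form.\<close>

definition singular_values ::
    "('k::field \<Rightarrow> real) \<Rightarrow> ('k \<Rightarrow> 'v::ab_group_add \<Rightarrow> 'v) \<Rightarrow> 'v set \<Rightarrow>
      ('k \<Rightarrow> 'w::ab_group_add \<Rightarrow> 'w) \<Rightarrow> 'w set \<Rightarrow> ('v \<Rightarrow> 'w) \<Rightarrow> real list"
  where "singular_values absv scl M scl' N T =
    (THE \<sigma>. \<exists>bs cs A D. R_basis absv scl M bs \<and> R_basis absv scl' N cs \<and>
      matrix_of scl' T bs cs A \<and> smith_normal_form absv A D \<and>
      \<sigma> = map (\<lambda>i. absv (D $$ (i, i))) [0..<min (dim_row D) (dim_col D)])"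


section \<open>Position vectors\<close>

fun epower :: "'a::semiring_1 \<Rightarrow> enat \<Rightarrow> 'a"
  where "epower a (enat m) = a ^ m"
  | "epower a \<infinity> = 0"

text \<open>The lattice of \<open>E \<times> F\<close> is the product of the lattices \<open>E \<inter> M\<close> and \<open>F \<inter> M\<close>.\<close>

definition addition_singular_values ::
    "('k::field \<Rightarrow> real) \<Rightarrow> ('k \<Rightarrow> 'v::ab_group_add \<Rightarrow> 'v) \<Rightarrow> 'v set \<Rightarrow> 'v set \<Rightarrow> 'v set \<Rightarrow> real list"
  where "addition_singular_values absv scl M E F =
    singular_values absv (module_prod.scale scl scl) ((E \<inter> M) \<times> (F \<inter> M)) scl M
      (\<lambda>(e, f). e + f)"

definition position_vector ::
    "('k::field \<Rightarrow> real) \<Rightarrow> ('k \<Rightarrow> 'v::ab_group_add \<Rightarrow> 'v) \<Rightarrow> 'v set \<Rightarrow> 'v set \<Rightarrow> 'v set \<Rightarrow>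
      enat list \<Rightarrow> bool"
  where "position_vector absv scl M E F xs \<longleftrightarrow>
    length xs = vector_space.dim scl E \<and> sorted xs \<and>
    addition_singular_values absv scl M E F =
      replicate (vector_space.dim scl F) 1 @ map (epower (epsilon absv)) xs"

end

theory Submission
  imports Defs "Jordan_Normal_Form.Determinant"
begin

text \<open>
  Call a family orthonormal if an \<open>R\<close>-basis of \<open>V_R\<close> extends it, that is, if it is orthonormal for the
  norm with unit ball \<open>V_R\<close>. Subspaces are closed (\<open>subspace_closed\<close>) and the valuation is discrete,
  so best approximations exist and orthonormal families extend inside any subspace
  (\<open>orthonormal_extend\<close>).

  The exponents \<open>x\<close> are those of the Smith normal form of the projection from \<open>E\<close> to the quotient of
  \<open>V\<close> by \<open>F\<close>. They are found greedily: among the vectors of \<open>E \<inter> V_R\<close>, modulo those already chosen,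
  one with largest image in the quotient is taken next. Its image is \<open>\<pi>^x\<close> times a vector that
  extends the orthonormal family, and the maximality both keeps the chosen vectors \<open>u\<close> of \<open>E\<close>
  orthonormal and makes the exponents increase (\<open>partial_finite_step\<close>). When only the zero image is
  left, the remaining vectors of \<open>E\<close> can be chosen in \<open>F\<close>, with infinite exponent. The result is
  \<open>u i = a i + \<pi>^(x i) f i\<close> with \<open>a i\<close> in \<open>F\<close>. Vectors \<open>a i\<close> with positive exponent are congruent to
  \<open>u i\<close> modulo \<open>\<pi>\<close> and can be made part of a basis of \<open>F\<close>; for exponent 0 the splitting of \<open>u i\<close> can be
  changed freely (\<open>ex_adapted_family\<close>).

  For the position vector, the addition map takes \<open>(0, e j)\<close> to \<open>e j\<close> and \<open>(u i, - e i)\<close> to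
  \<open>\<pi>^(x i) f i\<close>. These vectors form an \<open>R\<close>-basis of the product lattice, so the map is already in
  Smith normal form. That its diagonal gives the singular values requires their independence of the
  chosen bases and normal form, which follows from a min-max comparison of two diagonal forms
  (\<open>diagonal_absv_le\<close>).
\<close>

section \<open>The valuation\<close>

lemma epower_0 [simp]: "epower a 0 = 1"
  by (simp add: zero_enat_def)

lemma sum_lessThan_add:
  fixes g :: "nat \<Rightarrow> 'a::comm_monoid_add"
  shows "(\<Sum>i<l + j. g i) = (\<Sum>i<l. g i) + (\<Sum>i<j. g (l + i))"
  by (induction j) (simp_all add: add.assoc)

context nonarch_local_field
begin

abbreviation R :: "'k set"
  where "R \<equiv> valuation_ring absv"

lemma absv_zero [simp]: "absv 0 = 0"
  by (simp add: absv_eq_0_iff)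

lemma absv_one [simp]: "absv 1 = 1"
  using absv_mult[of 1 1] absv_eq_0_iff[of 1] by simp

lemma absv_power: "absv (a ^ m) = absv a ^ m"
  by (induction m) (simp_all add: absv_mult)

lemma absv_minus [simp]: "absv (- a) = absv a"
proof -
  have "absv (-1) * absv (-1) = 1"
    by (simp flip: absv_mult)
  then have "absv (-1) = 1"
    using absv_nonneg[of "-1"] square_eq_1_iff[of "absv (-1)"] by linarith
  then show ?thesis
    using absv_mult[of "-1" a] by simp
qed

lemma absv_inverse: "absv (inverse a) = inverse (absv a)"
proof (cases "a = 0")
  case False
  then have "absv a * absv (inverse a) = 1"
    by (simp flip: absv_mult)
  then show ?thesis
    by (rule inverse_unique[symmetric])
qed simp

lemma R_iff: "a \<in> R \<longleftrightarrow> absv a \<le> 1"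
  by (simp add: valuation_ring_def)

lemma R_0 [simp]: "0 \<in> R" and R_1 [simp]: "1 \<in> R"
  by (simp_all add: R_iff)

lemma R_minus_iff [simp]: "- a \<in> R \<longleftrightarrow> a \<in> R"
  by (simp add: R_iff)

lemma R_add: "a \<in> R \<Longrightarrow> b \<in> R \<Longrightarrow> a + b \<in> R"
  using absv_ultrametric[of a b] by (simp add: R_iff)

lemma R_mult: "a \<in> R \<Longrightarrow> b \<in> R \<Longrightarrow> a * b \<in> R"
  by (simp add: R_iff absv_mult absv_nonneg mult_le_one)

lemma R_sum: "(\<And>i. i \<in> I \<Longrightarrow> f i \<in> R) \<Longrightarrow> sum f I \<in> R"
  by (induction I rule: infinite_finite_induct) (auto intro: R_add)

lemma R_power: "a \<in> R \<Longrightarrow> a ^ m \<in> R"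
  by (induction m) (auto intro: R_mult)

lemma absv_uniformizer_pos: "0 < absv \<pi>"
  using uniformizer(1) absv_nonneg[of \<pi>] absv_eq_0_iff[of \<pi>] by linarith

lemma absv_uniformizer_less_1: "absv \<pi> < 1"
proof -
  have "\<pi> * 1 \<in> maximal_ideal absv"
    unfolding uniformizer(2) by (rule imageI) simp
  then show ?thesis
    by (simp add: maximal_ideal_def)
qed

lemma uniformizer_in_R [simp]: "\<pi> \<in> R"
  using absv_uniformizer_less_1 by (simp add: R_iff)

text \<open>The valuation is discrete: the inverse of a nonintegral element is not only small but divisible
  by \<open>\<pi>\<close>. Every maximality argument below gains its extra factor \<open>\<pi>\<close> from here.\<close>
lemma inverse_of_nonintegral:
  assumes "c \<notin> R"
  obtains r where "r \<in> R" "inverse c = \<pi> * r"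
proof -
  have "inverse c \<in> maximal_ideal absv"
    using assms by (simp add: R_iff maximal_ideal_def absv_inverse inverse_less_1_iff)
  then show ?thesis
    unfolding uniformizer(2) using that by auto
qed

lemma ex_power_mult_in_R: "\<exists>N. \<pi> ^ N * a \<in> R"
proof (cases "a = 0")
  case False
  then have "0 < absv a"
    using absv_nonneg[of a] absv_eq_0_iff[of a] by linarith
  then obtain N where "absv \<pi> ^ N < inverse (absv a)"
    using real_arch_pow_inv[of "inverse (absv a)", OF _ absv_uniformizer_less_1] by auto
  then have "absv \<pi> ^ N * absv a \<le> 1"
    using \<open>0 < absv a\<close> by (simp add: field_simps)
  then show ?thesis
    by (auto simp: R_iff absv_mult absv_power)
qed auto

text \<open>The normalization that stands in for reduction modulo \<open>\<pi>\<close>: dividing by an entry of largest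
  absolute value makes a nonzero vector integral with a unit among its entries.\<close>
lemma ex_scale_to_unit:
  assumes "finite I" "i \<in> I" "v i \<noteq> 0"
  obtains d j where "d \<noteq> 0" "j \<in> I" "absv (d * v j) = 1" "\<And>i. i \<in> I \<Longrightarrow> d * v i \<in> R"
proof -
  define m where "m = Max ((\<lambda>i. absv (v i)) ` I)"
  have "m \<in> (\<lambda>i. absv (v i)) ` I"
    unfolding m_def using assms by (intro Max_in) auto
  then obtain j where j: "j \<in> I" "absv (v j) = m"
    by auto
  have le: "absv (v i) \<le> absv (v j)" if "i \<in> I" for i
    using that assms(1) unfolding j(2) m_def by auto
  have "v j \<noteq> 0"
    using assms(3) absv_nonneg[of "v i"] absv_eq_0_iff[of "v i"] le[OF assms(2)] by auto
  then have pos: "0 < absv (v j)"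
    using absv_nonneg[of "v j"] absv_eq_0_iff[of "v j"] by linarith
  show ?thesis
  proof (rule that[of "inverse (v j)" j])
    show "inverse (v j) * v i \<in> R" if "i \<in> I" for i
      using le[OF that] pos
      unfolding R_iff absv_mult absv_inverse by (simp add: field_simps)
  qed (use \<open>v j \<noteq> 0\<close> j in auto)
qed

lemma epower_in_R [simp]: "epower \<pi> x \<in> R"
  by (cases x) (auto intro: R_power)

lemma absv_epower: "absv (epower \<pi> x) = epower (epsilon absv) x"
  by (cases x) (auto simp: absv_power absv_uniformizer)

lemma epower_mono:
  assumes "x \<le> y"
  obtains r where "r \<in> R" "epower \<pi> y = r * epower \<pi> x"
proof (cases y)
  case (enat m)
  then obtain m' where m': "x = enat m'"
    using assms by (cases x) auto
  then have "epower \<pi> y = \<pi> ^ (m - m') * epower \<pi> x"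
    using assms enat by (simp flip: power_add)
  then show ?thesis
    using that R_power uniformizer_in_R by blast
next
  case infinity
  then show ?thesis
    using that[of 0] by simp
qed

text \<open>A system of \<open>m\<close> equations in \<open>m + 1\<close> unknowns has a nonzero solution, because the matrix padded
  with a zero row is singular; such a solution can be rescaled to be integral with a unit entry.\<close>
lemma ex_kernel_vector:
  fixes a :: "nat \<Rightarrow> nat \<Rightarrow> 'k"
  shows "\<exists>v. (\<exists>j\<le>m. absv (v j) = 1) \<and> (\<forall>i\<le>m. v i \<in> R) \<and> (\<forall>r<m. (\<Sum>i\<le>m. a r i * v i) = 0)"
proof -
  define A where "A = mat (Suc m) (Suc m) (\<lambda>(r, i). if r < m then a r i else 0)"
  have A: "A \<in> carrier_mat (Suc m) (Suc m)"
    by (simp add: A_def)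
  have "A = mat\<^sub>r (Suc m) (Suc m) (\<lambda>r. if r = m then 0\<^sub>v (Suc m) else row A r)"
    by (rule eq_matI) (auto simp: A_def)
  then have "det A = 0"
    using det_row_0[of m "Suc m" "row A"] A by auto
  then obtain w where w: "w \<in> carrier_vec (Suc m)" "w \<noteq> 0\<^sub>v (Suc m)" "A *\<^sub>v w = 0\<^sub>v (Suc m)"
    using det_0_iff_vec_prod_zero_field[OF A] by blast
  have "\<exists>i\<in>{..m}. w $ i \<noteq> 0"
    using w(1,2) by (auto simp: less_Suc_eq_le)
  then obtain d j where d: "d \<noteq> 0" "j \<le> m" "absv (d * w $ j) = 1"
      "\<And>i. i \<le> m \<Longrightarrow> d * w $ i \<in> R"
    using ex_scale_to_unit[of "{..m}" _ "($) w"] by (auto simp del: One_nat_def)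
  show ?thesis
  proof (intro exI[of _ "\<lambda>i. d * w $ i"] conjI allI impI)
    fix r assume "r < m"
    then have "(\<Sum>i\<le>m. a r i * w $ i) = (A *\<^sub>v w) $ r"
      using w(1) by (simp add: A_def scalar_prod_def atLeast0LessThan lessThan_Suc_atMost)
    then have "(\<Sum>i\<le>m. a r i * w $ i) = 0"
      using \<open>r < m\<close> w(3) by simp
    then show "(\<Sum>i\<le>m. a r i * (d * w $ i)) = 0"
      by (simp add: mult.left_commute[of _ d] flip: sum_distrib_left)
  qed (use d in auto)
qed

end

section \<open>Orthonormal families\<close>

locale full_lattice =
  nonarch_local_field absv \<pi> + finite_dimensional_vector_space scl Basis
  for absv :: "'k::field_char_0 \<Rightarrow> real" and \<pi> :: 'k
    and scl :: "'k \<Rightarrow> 'v::ab_group_add \<Rightarrow> 'v" (infixr "*s" 75) and Basis :: "'v set" +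
  fixes M :: "'v set"
  assumes linear_structure: "linear_R_structure absv scl M"
begin

lemma M_0 [simp]: "0 \<in> M"
  and M_add: "x \<in> M \<Longrightarrow> y \<in> M \<Longrightarrow> x + y \<in> M"
  and M_scale: "a \<in> R \<Longrightarrow> x \<in> M \<Longrightarrow> a *s x \<in> M"
  using linear_structure by (auto simp: linear_R_structure_def R_submodule_def)

lemma M_minus: "x \<in> M \<Longrightarrow> - x \<in> M"
  using M_scale[of "-1" x] by (simp add: scale_minus_left)

lemma M_diff: "x \<in> M \<Longrightarrow> y \<in> M \<Longrightarrow> x - y \<in> M"
  using M_add[of x "- y"] M_minus[of y] by simp

lemma M_sum: "(\<And>i. i \<in> I \<Longrightarrow> f i \<in> M) \<Longrightarrow> sum f I \<in> M"
  by (induction I rule: infinite_finite_induct) (auto intro: M_add)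

text \<open>A vector is a combination of finitely many lattice vectors, and a single power of \<open>\<pi>\<close> makes all
  its coefficients integral.\<close>
lemma ex_power_scale_in_M: "\<exists>N. \<pi> ^ N *s v \<in> M"
proof -
  have "v \<in> span M"
    using linear_structure by (simp add: linear_R_structure_def)
  then show ?thesis
  proof (induction rule: span_induct_alt)
    case base
    then show ?case by simp
  next
    case (step a x y)
    obtain N1 N2 where N: "\<pi> ^ N1 *s y \<in> M" "\<pi> ^ N2 * a \<in> R"
      using step.IH ex_power_mult_in_R by blast
    have "\<pi> ^ N1 *s (\<pi> ^ N2 * a) *s x + \<pi> ^ N2 *s \<pi> ^ N1 *s y \<in> M"
      by (rule M_add[OF M_scale[OF R_power M_scale[OF N(2)]] M_scale[OF R_power N(1)]])
        (use step.hyps in auto)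
    also have "\<pi> ^ N1 *s (\<pi> ^ N2 * a) *s x + \<pi> ^ N2 *s \<pi> ^ N1 *s y
        = \<pi> ^ (N1 + N2) *s (a *s x + y)"
      by (simp add: scale_right_distrib power_add mult_ac)
    finally show ?case ..
  qed
qed

text \<open>By the ultrametric inequality, the values at finitely many generators bound the functional.\<close>
lemma functional_bounded_on_M:
  assumes "Vector_Spaces.linear scl (*) \<phi>"
  obtains C where "\<And>x. x \<in> M \<Longrightarrow> absv (\<phi> x) \<le> C"
proof -
  interpret \<phi>: Vector_Spaces.linear scl "(*)" \<phi> by fact
  obtain S where S: "finite S" "S \<subseteq> M"
    "\<And>x. x \<in> M \<Longrightarrow> \<exists>c. (\<forall>s\<in>S. c s \<in> R) \<and> x = (\<Sum>s\<in>S. c s *s s)"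
    using linear_structure unfolding linear_R_structure_def R_finitely_generated_def by metis
  have "absv (\<Sum>s\<in>T. c s * \<phi> s) \<le> (\<Sum>s\<in>T. absv (\<phi> s))" if "finite T" "\<forall>s\<in>T. c s \<in> R" for T c
    using that
  proof (induction T)
    case (insert t T)
    have "absv (c t * \<phi> t) \<le> absv (\<phi> t)"
      using insert.prems by (simp add: R_iff absv_mult absv_nonneg mult_left_le_one_le)
    moreover have "absv (\<Sum>s\<in>T. c s * \<phi> s) \<le> (\<Sum>s\<in>T. absv (\<phi> s))"
      using insert by simp
    moreover have "0 \<le> absv (\<phi> t)" "0 \<le> (\<Sum>s\<in>T. absv (\<phi> s))"
      by (auto intro: sum_nonneg absv_nonneg)
    ultimately show ?case
      using insert.hyps absv_ultrametric[of "c t * \<phi> t" "\<Sum>s\<in>T. c s * \<phi> s"] by simp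
  qed simp
  note bound = this
  have "absv (\<phi> x) \<le> (\<Sum>s\<in>S. absv (\<phi> s))" if x: "x \<in> M" for x
  proof -
    obtain c where c: "\<forall>s\<in>S. c s \<in> R" "x = (\<Sum>s\<in>S. c s *s s)"
      using S(3)[OF x] by blast
    have "\<phi> x = (\<Sum>s\<in>S. c s * \<phi> s)"
      by (simp add: c(2) \<phi>.sum \<phi>.scale)
    then show ?thesis
      using bound[OF S(1) c(1)] by simp
  qed
  then show ?thesis
    using that by blast
qed

text \<open>Subspaces are closed in the topology given by the lattice. A functional that vanishes on \<open>S\<close> and
  takes the value 1 at \<open>w\<close> would take arbitrarily large values \<open>\<pi> ^ -s\<close> on \<open>M\<close>, although it is
  bounded there.\<close>
lemma subspace_closed:
  assumes S: "subspace S" and approx: "\<And>s. \<exists>p\<in>S. \<exists>m\<in>M. w = p + \<pi> ^ s *s m"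
  shows "w \<in> S"
proof (rule ccontr)
  assume "w \<notin> S"
  obtain B where B: "B \<subseteq> S" "independent B" "S = span B"
    using basis_exists[of S] S by (metis span_eq_iff span_mono subset_antisym)
  interpret vp: vector_space_pair scl "(*) :: 'k \<Rightarrow> 'k \<Rightarrow> 'k"
    by unfold_locales (auto simp: algebra_simps)
  have "independent (insert w B)"
    using B \<open>w \<notin> S\<close> by (simp add: independent_insertI)
  then obtain \<phi> where \<phi>: "Vector_Spaces.linear scl (*) \<phi>"
      "\<forall>x\<in>insert w B. \<phi> x = (if x = w then 1 else 0)"
    using vp.linear_independent_extend[of "insert w B" "\<lambda>x. if x = w then 1 else 0"] by blast
  interpret \<phi>: Vector_Spaces.linear scl "(*)" \<phi> by fact
  have \<phi>_S: "\<phi> p = 0" if "p \<in> S" for p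
  proof -
    have "\<phi> x = 0" if "x \<in> B" for x
      using that \<phi>(2) B(1) \<open>w \<notin> S\<close> by auto
    then show ?thesis
      using that vp.linear_eq_0_on_span[OF \<phi>(1)] B(3) by blast
  qed
  obtain C where C: "\<And>x. x \<in> M \<Longrightarrow> absv (\<phi> x) \<le> C"
    using functional_bounded_on_M[OF \<phi>(1)] by blast
  have bound: "1 \<le> absv \<pi> ^ s * C" for s
  proof -
    obtain p m where "p \<in> S" "m \<in> M" "w = p + \<pi> ^ s *s m"
      using approx by blast
    then have "\<pi> ^ s * \<phi> m = 1"
      using \<phi>(2) \<phi>_S by (auto simp: \<phi>.add \<phi>.scale)
    then have "absv \<pi> ^ s * absv (\<phi> m) = 1"
      by (simp flip: absv_mult absv_power)
    then show ?thesis
      using C[OF \<open>m \<in> M\<close>] absv_uniformizer_pos by (metis mult_left_mono zero_le_power less_imp_le)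
  qed
  then have "0 < C"
    using bound[of 0] by simp
  then obtain s where "absv \<pi> ^ s < inverse C"
    using real_arch_pow_inv[of "inverse C", OF _ absv_uniformizer_less_1] by auto
  then show False
    using bound[of s] \<open>0 < C\<close> by (simp add: field_simps)
qed

text \<open>This is orthonormality for the norm whose unit ball is \<open>M\<close>: the norm of a linear combination is
  the largest absolute value of a coefficient. Equivalently, the family is an \<open>R\<close>-basis of the
  intersection of its span with \<open>M\<close>. Families indexed by sets of numbers, rather than lists, allow
  a family to be extended at prescribed positions.\<close>
definition orthonormal :: "(nat \<Rightarrow> 'v) \<Rightarrow> nat set \<Rightarrow> bool"
  where "orthonormal b I \<longleftrightarrow>
    finite I \<and> (\<forall>c. (\<Sum>i\<in>I. c i *s b i) \<in> M \<longleftrightarrow> (\<forall>i\<in>I. c i \<in> R))"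

lemma orthonormal_finite: "orthonormal b I \<Longrightarrow> finite I"
  by (simp add: orthonormal_def)

lemma orthonormalI:
  assumes "finite I" "\<And>i. i \<in> I \<Longrightarrow> b i \<in> M"
    and "\<And>c i. (\<Sum>i\<in>I. c i *s b i) \<in> M \<Longrightarrow> i \<in> I \<Longrightarrow> c i \<in> R"
  shows "orthonormal b I"
  unfolding orthonormal_def using assms by (auto intro!: M_sum M_scale)

lemma orthonormal_coeff:
  "orthonormal b I \<Longrightarrow> (\<Sum>i\<in>I. c i *s b i) \<in> M \<Longrightarrow> i \<in> I \<Longrightarrow> c i \<in> R"
  by (auto simp: orthonormal_def)

lemma orthonormal_in_M:
  assumes "orthonormal b I" "i \<in> I"
  shows "b i \<in> M"
proof -
  have "(\<Sum>j\<in>I. (if j = i then 1 else 0) *s b j) \<in> M"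
    using assms(1) unfolding orthonormal_def by auto
  also have "(\<Sum>j\<in>I. (if j = i then 1 else 0) *s b j) = (\<Sum>j\<in>I. if j = i then b j else 0)"
    by (intro sum.cong) auto
  also have "\<dots> = b i"
    using assms orthonormal_finite by (simp add: sum.delta)
  finally show ?thesis .
qed

lemma orthonormal_cong:
  "(\<And>i. i \<in> I \<Longrightarrow> b i = b' i) \<Longrightarrow> orthonormal b I \<longleftrightarrow> orthonormal b' I"
  by (simp add: orthonormal_def cong: sum.cong)

lemma orthonormal_subset:
  assumes "orthonormal b I" "J \<subseteq> I"
  shows "orthonormal b J"
proof (rule orthonormalI)
  show "finite J"
    using assms finite_subset orthonormal_finite by blast
  fix c i assume c: "(\<Sum>i\<in>J. c i *s b i) \<in> M" "i \<in> J"
  have "(\<Sum>i\<in>I. (if i \<in> J then c i else 0) *s b i) = (\<Sum>i\<in>J. c i *s b i)"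
    using assms orthonormal_finite by (intro sum.mono_neutral_cong_right) auto
  then have "(if i \<in> J then c i else 0) \<in> R"
    using assms c by (intro orthonormal_coeff[of b I]) auto
  then show "c i \<in> R"
    using c(2) by simp
qed (use assms orthonormal_in_M in auto)

text \<open>In a vanishing combination all coefficients may be scaled by an arbitrary factor, and so a nonzero
  one could be made nonintegral.\<close>
lemma orthonormal_zero_coeff:
  assumes "orthonormal b I" "(\<Sum>i\<in>I. c i *s b i) = 0" "i \<in> I"
  shows "c i = 0"
proof (rule ccontr)
  assume "c i \<noteq> 0"
  define d where "d = inverse (\<pi> * c i)"
  have "(\<Sum>i\<in>I. (d * c i) *s b i) = d *s (\<Sum>i\<in>I. c i *s b i)"
    by (simp add: scale_sum_right)
  then have "d * c i \<in> R"
    using assms orthonormal_coeff[of b I "\<lambda>i. d * c i"] by simp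
  moreover have "d * c i = inverse \<pi>"
    using \<open>c i \<noteq> 0\<close> by (simp add: d_def)
  ultimately show False
    using absv_uniformizer_less_1 absv_uniformizer_pos by (simp add: R_iff absv_inverse inverse_le_1_iff)
qed

lemma span_family:
  assumes "finite I"
  shows "span (b ` I) = {\<Sum>i\<in>I. c i *s b i | c. True}"
proof
  show "span (b ` I) \<subseteq> {\<Sum>i\<in>I. c i *s b i | c. True}"
  proof
    fix x assume "x \<in> span (b ` I)"
    then show "x \<in> {\<Sum>i\<in>I. c i *s b i | c. True}"
    proof (induction rule: span_induct_alt)
      case base
      show ?case
        by (auto intro!: exI[of _ "\<lambda>_. 0"])
    next
      case (step a y z)
      then obtain c j where cj: "z = (\<Sum>i\<in>I. c i *s b i)" "y = b j" "j \<in> I" by auto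
      have "a *s y = (\<Sum>i\<in>I. if i = j then a *s b i else 0)"
        using cj assms by simp
      also have "\<dots> = (\<Sum>i\<in>I. (if i = j then a else 0) *s b i)"
        by (intro sum.cong) auto
      finally have "a *s y + z = (\<Sum>i\<in>I. ((if i = j then a else 0) + c i) *s b i)"
        by (simp add: cj scale_left_distrib sum.distrib)
      then show ?case
        by (intro CollectI exI[of _ "\<lambda>i. (if i = j then a else 0) + c i"]) simp
    qed
  qed
qed (auto intro: span_sum span_scale span_base)

lemma orthonormal_independent:
  assumes "orthonormal b I"
  shows "inj_on b I" "independent (b ` I)"
proof -
  note fin = orthonormal_finite[OF assms]
  show inj: "inj_on b I"
  proof (rule inj_onI, rule ccontr)
    fix i j assume ij: "i \<in> I" "j \<in> I" "b i = b j" "i \<noteq> j"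
    have "(\<Sum>k\<in>I. ((if k = i then 1 else 0) - (if k = j then 1 else 0)) *s b k)
        = (\<Sum>k\<in>I. (if k = i then b k else 0) - (if k = j then b k else 0))"
      by (intro sum.cong) (auto simp: scale_minus_left)
    also have "\<dots> = 0"
      using fin ij by (simp add: sum_subtractf)
    finally have "(if i = i then 1 else 0) - (if i = j then 1 else 0) = (0 :: 'k)"
      by (rule orthonormal_zero_coeff[OF assms _ ij(1)])
    then show False
      using ij(4) by simp
  qed
  show "independent (b ` I)"
  proof (rule independent_if_scalars_zero)
    fix f x assume f: "(\<Sum>x\<in>b ` I. f x *s x) = 0" "x \<in> b ` I"
    then obtain i where "i \<in> I" "x = b i" by auto
    moreover have "(\<Sum>i\<in>I. f (b i) *s b i) = 0"
      using f(1) inj by (simp add: sum.reindex)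
    ultimately show "f x = 0"
      using orthonormal_zero_coeff[OF assms, of "\<lambda>i. f (b i)"] by auto
  qed (use fin in auto)
qed

lemma orthonormal_span:
  assumes "orthonormal b I" "b ` I \<subseteq> U" "subspace U" "dim U \<le> card I"
  shows "span (b ` I) = U"
proof
  show "span (b ` I) \<subseteq> U"
    using assms span_minimal by blast
  have "card (b ` I) = card I"
    using orthonormal_independent[OF assms(1)] card_image by blast
  then show "U \<subseteq> span (b ` I)"
    using assms orthonormal_independent[OF assms(1)] by (intro card_ge_dim_independent) auto
qed

lemma orthonormal_dim_span:
  assumes "orthonormal b I"
  shows "dim (span (b ` I)) = card I"
  using orthonormal_independent[OF assms] by (simp add: dim_eq_card_independent card_image)

text \<open>The vector \<open>u\<close> of \<open>M\<close> has the largest possible distance 1 from \<open>S\<close>; equivalently, its reduction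
  modulo \<open>\<pi>\<close> is not in the reduction of \<open>S \<inter> M\<close>.\<close>
definition transverse :: "'v set \<Rightarrow> 'v \<Rightarrow> bool"
  where "transverse S u \<longleftrightarrow> u \<in> M \<and> (\<forall>p\<in>S. \<forall>m\<in>M. u \<noteq> p + \<pi> *s m)"

text \<open>If the coefficient of \<open>u\<close> in an integral combination were not integral, division by it would bring
  \<open>u\<close> into \<open>S + \<pi> M\<close>, where \<open>S\<close> is the span of the family.\<close>
lemma orthonormal_insert:
  assumes b: "orthonormal b I" and "j \<notin> I" and u: "transverse (span (b ` I)) u"
  shows "orthonormal (b(j := u)) (insert j I)"
proof (rule orthonormalI)
  note fin = orthonormal_finite[OF b]
  fix c i
  assume sum: "(\<Sum>i\<in>insert j I. c i *s (b(j := u)) i) \<in> M" and i: "i \<in> insert j I"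
  have "(\<Sum>i\<in>I. c i *s (b(j := u)) i) = (\<Sum>i\<in>I. c i *s b i)"
    using \<open>j \<notin> I\<close> by (intro sum.cong) auto
  then have sum': "c j *s u + (\<Sum>i\<in>I. c i *s b i) \<in> M" (is "?x \<in> M")
    using sum fin \<open>j \<notin> I\<close> by simp
  have cj: "c j \<in> R"
  proof (rule ccontr)
    assume "c j \<notin> R"
    then obtain r where r: "r \<in> R" "inverse (c j) = \<pi> * r"
      by (rule inverse_of_nonintegral)
    have "c j \<noteq> 0"
      using \<open>c j \<notin> R\<close> by auto
    then have "u = inverse (c j) *s ?x - inverse (c j) *s (\<Sum>i\<in>I. c i *s b i)"
      by (simp add: scale_right_distrib)
    also have "\<dots> = - (inverse (c j) *s (\<Sum>i\<in>I. c i *s b i)) + \<pi> *s r *s ?x"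
      by (simp add: r(2))
    finally have "u = - (inverse (c j) *s (\<Sum>i\<in>I. c i *s b i)) + \<pi> *s r *s ?x" .
    moreover have "- (inverse (c j) *s (\<Sum>i\<in>I. c i *s b i)) \<in> span (b ` I)"
      by (intro span_neg span_scale span_sum span_base) auto
    ultimately show False
      using u M_scale[OF r(1) sum'] unfolding transverse_def by blast
  qed
  have "(\<Sum>i\<in>I. c i *s b i) = ?x - c j *s u"
    by simp
  also have "\<dots> \<in> M"
    using sum' cj u by (intro M_diff M_scale) (auto simp: transverse_def)
  finally show "c i \<in> R"
    using i cj orthonormal_coeff[OF b] by auto
qed (use assms orthonormal_finite orthonormal_in_M transverse_def in auto)

text \<open>Take a vector of \<open>U\<close> outside the span \<open>S\<close> of the family and subtract from it a best approximation
  in \<open>S\<close>. The approximation exists because the distance is positive by closedness of \<open>S\<close> and the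
  valuation is discrete; the rescaled difference is transverse to \<open>S\<close>.\<close>
lemma ex_transverse:
  assumes b: "orthonormal b I" and U: "subspace U" "b ` I \<subseteq> U" and card: "card I < dim U"
  obtains u where "u \<in> U" "transverse (span (b ` I)) u"
proof -
  let ?S = "span (b ` I)"
  have "\<not> U \<subseteq> ?S"
    using card orthonormal_dim_span[OF b] dim_subset[of U ?S] by auto
  then obtain v0 where v0: "v0 \<in> U" "v0 \<notin> ?S"
    by auto
  obtain N where N: "\<pi> ^ N *s v0 \<in> M"
    using ex_power_scale_in_M by blast
  define v where "v = \<pi> ^ N *s v0"
  have v: "v \<in> U" "v \<in> M"
    using v0 N U by (auto simp: v_def subspace_scale)
  have "v \<notin> ?S"
  proof
    assume "v \<in> ?S"
    then have "inverse (\<pi> ^ N) *s v \<in> ?S"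
      by (rule span_scale)
    then show False
      using v0(2) uniformizer(1) by (simp add: v_def)
  qed
  define near where "near s \<longleftrightarrow> (\<exists>p\<in>?S. \<exists>m\<in>M. v = p + \<pi> ^ s *s m)" for s
  have "near 0"
    using v(2) span_zero unfolding near_def by force
  moreover have "\<exists>s. \<not> near s"
    using subspace_closed[of ?S v] \<open>v \<notin> ?S\<close> unfolding near_def by (metis subspace_span)
  ultimately obtain s where s: "near s" "\<not> near (Suc s)"
    by (metis nat_induct)
  then obtain p u where pu: "p \<in> ?S" "u \<in> M" "v = p + \<pi> ^ s *s u"
    unfolding near_def by blast
  have "u \<in> U"
  proof -
    have "p \<in> U"
      using pu(1) U span_minimal by blast
    then have "inverse (\<pi> ^ s) *s (v - p) \<in> U"
      using v(1) U by (intro subspace_scale subspace_diff)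
    then show ?thesis
      using uniformizer(1) by (simp add: pu(3))
  qed
  moreover have "transverse ?S u"
    unfolding transverse_def
  proof (intro conjI ballI)
    fix q m assume "q \<in> ?S" "m \<in> M"
    show "u \<noteq> q + \<pi> *s m"
    proof
      assume "u = q + \<pi> *s m"
      then have "v = (p + \<pi> ^ s *s q) + \<pi> ^ Suc s *s m"
        by (simp add: pu(3) scale_right_distrib mult.commute)
      moreover have "p + \<pi> ^ s *s q \<in> ?S"
        using pu(1) \<open>q \<in> ?S\<close> by (intro span_add span_scale)
      ultimately show False
        using s(2) \<open>m \<in> M\<close> unfolding near_def by blast
    qed
  qed (fact pu(2))
  ultimately show ?thesis
    using that by blast
qed

lemma orthonormal_extend:
  assumes b: "orthonormal b I" and U: "subspace U" "b ` I \<subseteq> U"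
    and J: "finite J" "I \<subseteq> J" "card J \<le> dim U"
  obtains b' where "orthonormal b' J" "b' ` J \<subseteq> U" "\<And>i. i \<in> I \<Longrightarrow> b' i = b i"
proof -
  have "\<exists>b'. orthonormal b' (I \<union> K) \<and> b' ` (I \<union> K) \<subseteq> U \<and> (\<forall>i\<in>I. b' i = b i)"
    if "finite K" "K \<subseteq> J - I" for K
    using that
  proof (induction K)
    case empty
    then show ?case using b U by auto
  next
    case (insert j K)
    then obtain b' where b': "orthonormal b' (I \<union> K)" "b' ` (I \<union> K) \<subseteq> U" "\<forall>i\<in>I. b' i = b i"
      by auto
    have j: "j \<notin> I \<union> K"
      using insert by auto
    then have "I \<union> K \<subset> J"
      using insert.prems J(2) by auto
    then have "card (I \<union> K) < dim U"
      using psubset_card_mono[OF J(1), of "I \<union> K"] J(3) by simp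
    then obtain u where u: "u \<in> U" "orthonormal (b'(j := u)) (insert j (I \<union> K))"
      using ex_transverse[OF b'(1) U(1) b'(2)] orthonormal_insert[OF b'(1) j] by blast
    moreover have "\<forall>i\<in>I. (b'(j := u)) i = b i"
      using b'(3) j by auto
    moreover have "(b'(j := u)) ` (insert j (I \<union> K)) \<subseteq> U"
      using b'(2) u(1) by auto
    ultimately show ?case
      unfolding Un_insert_right by blast
  qed
  from this[of "J - I"] show ?thesis
    using J that by (auto simp: Un_absorb1)
qed

lemma orthonormal_R_basis:
  assumes b: "orthonormal b {..<m}" and "dim (UNIV :: 'v set) = m"
  shows "R_basis absv scl M (map b [0..<m])"
proof -
  have nth: "(\<Sum>i<length (map b [0..<m]). c i *s (map b [0..<m] ! i)) = (\<Sum>i<m. c i *s b i)" for c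
    by (intro sum.cong) auto
  have "span (b ` {..<m}) = UNIV"
    using assms by (intro orthonormal_span[OF b]) auto
  then have "\<exists>c. x = (\<Sum>i<m. c i *s b i)" for x
    using span_family[of "{..<m}" b] by blast
  then have "\<exists>c. (\<forall>i<m. c i \<in> R) \<and> x = (\<Sum>i<m. c i *s b i)" if "x \<in> M" for x
    using that orthonormal_coeff[OF b] by (metis lessThan_iff)
  then show ?thesis
    unfolding R_basis_def nth
    using orthonormal_in_M[OF b] orthonormal_zero_coeff[OF b] by auto
qed

end

section \<open>Relative position of two subspaces\<close>

context full_lattice
begin

lemma span_mono_family: "I \<subseteq> J \<Longrightarrow> span (b ` I) \<subseteq> span (b ` J)"
  by (intro span_mono image_mono)

text \<open>Modulo \<open>F\<close>, the lattice of \<open>E\<close> lies in the \<open>R\<close>-span of \<open>u\<close> up to an error in \<open>\<pi>^t M\<close>; for infinite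
  \<open>t\<close> there is no error. In terms of the map from \<open>E\<close> to the quotient by \<open>F\<close>, the singular values
  that are not yet accounted for by \<open>u\<close> are at most \<open>\<epsilon>^t\<close>.\<close>
definition covers :: "'v set \<Rightarrow> 'v set \<Rightarrow> nat \<Rightarrow> (nat \<Rightarrow> 'v) \<Rightarrow> enat \<Rightarrow> bool"
  where "covers E F j u t \<longleftrightarrow>
    (\<forall>w\<in>E \<inter> M. \<exists>c m. (\<forall>i<j. c i \<in> R) \<and> m \<in> M \<and>
      w - (\<Sum>i<j. c i *s u i) - epower \<pi> t *s m \<in> F)"

lemma covers_mono:
  assumes "covers E F j u t" "s \<le> t"
  shows "covers E F j u s"
  unfolding covers_def
proof
  fix w assume "w \<in> E \<inter> M"
  then obtain c m where cm: "\<forall>i<j. c i \<in> R" "m \<in> M"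
      "w - (\<Sum>i<j. c i *s u i) - epower \<pi> t *s m \<in> F"
    using assms(1) unfolding covers_def by blast
  obtain r where r: "r \<in> R" "epower \<pi> t = r * epower \<pi> s"
    using epower_mono[OF assms(2)] by blast
  have "epower \<pi> t *s m = epower \<pi> s *s (r *s m)"
    by (simp add: r(2) mult.commute)
  then show "\<exists>c m. (\<forall>i<j. c i \<in> R) \<and> m \<in> M \<and>
      w - (\<Sum>i<j. c i *s u i) - epower \<pi> s *s m \<in> F"
    using cm M_scale[OF r(1) cm(2)] by metis
qed

text \<open>The state of the greedy construction after \<open>j\<close> steps. The family \<open>b\<close> consists of an orthonormal
  basis of \<open>F\<close> at the indices below \<open>l\<close>, followed by the \<open>j\<close> vectors found so far outside \<open>F\<close>, and
  \<open>u i\<close> is a vector of \<open>E\<close> congruent to \<open>\<pi>^(x i) b (l + i)\<close> modulo \<open>F\<close>. The exponent \<open>t\<close> is a lower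
  bound for all exponents still to come.\<close>
definition partial_position :: "'v set \<Rightarrow> 'v set \<Rightarrow> nat \<Rightarrow> nat \<Rightarrow> (nat \<Rightarrow> 'v) \<Rightarrow> (nat \<Rightarrow> 'v) \<Rightarrow>
    (nat \<Rightarrow> enat) \<Rightarrow> enat \<Rightarrow> bool"
  where "partial_position E F l j b u x t \<longleftrightarrow>
    orthonormal b {..<l + j} \<and> span (b ` {..<l}) = F \<and>
    orthonormal u {..<j} \<and> (\<forall>i<j. u i \<in> E \<and> u i - epower \<pi> (x i) *s b (l + i) \<in> F) \<and>
    (\<forall>i<j. x i \<le> t) \<and> (\<forall>i<j. \<forall>i'<i. x i' \<le> x i) \<and> covers E F j u t"

text \<open>In the quotient by the span of the first \<open>l\<close> vectors, the remaining ones are still orthonormal.\<close>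
lemma coeff_modulo_span:
  assumes b: "orthonormal b {..<l + j}" and p: "p \<in> span (b ` {..<l})"
    and M: "p + (\<Sum>i<j. a i *s b (l + i)) \<in> M" and "i < j"
  shows "a i \<in> R"
proof -
  obtain d where "p = (\<Sum>i<l. d i *s b i)"
    using p by (auto simp: span_family)
  then have "(\<Sum>i<l + j. (if i < l then d i else a (i - l)) *s b i) \<in> M"
    using M by (simp add: sum_lessThan_add)
  from orthonormal_coeff[OF b this, of "l + i"] show ?thesis
    using \<open>i < j\<close> by simp
qed

context
  fixes E F :: "'v set" and l j :: nat and b u :: "nat \<Rightarrow> 'v" and x :: "nat \<Rightarrow> enat" and t :: enat
  assumes partial_position: "partial_position E F l j b u x t"
begin

lemma partial_b: "orthonormal b {..<l + j}"
  and partial_F: "span (b ` {..<l}) = F"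
  and partial_u: "orthonormal u {..<j}"
  and partial_u_E: "i < j \<Longrightarrow> u i \<in> E"
  and partial_u_b: "i < j \<Longrightarrow> u i - epower \<pi> (x i) *s b (l + i) \<in> F"
  and partial_x: "i < j \<Longrightarrow> x i \<le> t"
  and partial_covers: "covers E F j u t"
  using partial_position by (auto simp: partial_position_def)

lemma partial_subspace_F: "subspace F"
  using partial_F by auto

lemma partial_F_subset: "F \<subseteq> span (b ` {..<l + j})"
  unfolding partial_F[symmetric] by (intro span_mono_family) auto

lemma partial_u_span: "i < j \<Longrightarrow> u i \<in> span (b ` {..<l + j})"
proof -
  assume i: "i < j"
  then have "epower \<pi> (x i) *s b (l + i) \<in> span (b ` {..<l + j})"
    by (intro span_scale span_base) auto
  moreover have "u i - epower \<pi> (x i) *s b (l + i) \<in> span (b ` {..<l + j})"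
    using partial_u_b[OF i] partial_F_subset by auto
  ultimately show ?thesis
    using span_add by fastforce
qed

lemma partial_span_split:
  assumes "w \<in> span (b ` {..<l + j})"
  obtains p a where "p \<in> F" "w = p + (\<Sum>i<j. a i *s b (l + i))"
proof -
  obtain d where "w = (\<Sum>i<l. d i *s b i) + (\<Sum>i<j. d (l + i) *s b (l + i))"
    using assms by (auto simp: span_family sum_lessThan_add)
  moreover have "(\<Sum>i<l. d i *s b i) \<in> F"
    unfolding partial_F[symmetric] by (intro span_sum span_scale span_base) auto
  ultimately show ?thesis
    using that[of _ "\<lambda>i. d (l + i)"] by blast
qed

lemma partial_sum_modulo_F:
  "(\<Sum>i<j. c i *s u i) - (\<Sum>i<j. (c i * epower \<pi> (x i)) *s b (l + i)) \<in> F"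
proof -
  have "(\<Sum>i<j. c i *s (u i - epower \<pi> (x i) *s b (l + i))) \<in> F"
    using partial_u_b partial_subspace_F by (intro subspace_sum subspace_scale) auto
  then show ?thesis
    by (simp add: scale_right_diff_distrib sum_subtractf)
qed

text \<open>The coefficients in the coverings may change with the precision, so there is no limit to take
  directly. Instead, closedness puts \<open>w\<close> into the span of \<open>b\<close>, and the precision \<open>t\<close>, which is at
  least every \<open>x i\<close>, already shows that the coordinate of \<open>w\<close> at \<open>l + i\<close> is an integral multiple of
  \<open>\<pi>^(x i)\<close>.\<close>
lemma covers_infinity:
  assumes all: "\<And>s. covers E F j u (enat s)"
  shows "covers E F j u \<infinity>"
proof (cases t)
  case infinity
  then show ?thesis
    using partial_covers by simp
next
  case (enat t0)
  let ?S = "span (b ` {..<l + j})"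
  show ?thesis
    unfolding covers_def
  proof
    fix w assume w: "w \<in> E \<inter> M"
    have "w \<in> ?S"
    proof (rule subspace_closed)
      fix s
      obtain c m where cm: "m \<in> M" "w - (\<Sum>i<j. c i *s u i) - epower \<pi> (enat s) *s m \<in> F"
        using all[of s] w unfolding covers_def by blast
      have "(w - (\<Sum>i<j. c i *s u i) - \<pi> ^ s *s m) + (\<Sum>i<j. c i *s u i) \<in> ?S"
        using cm(2) partial_F_subset partial_u_span by (intro span_add span_sum span_scale) auto
      then show "\<exists>p\<in>?S. \<exists>m\<in>M. w = p + \<pi> ^ s *s m"
        using cm(1) by (intro bexI[of _ "w - \<pi> ^ s *s m"] bexI[of _ m]) (simp_all add: algebra_simps)
    qed (simp add: subspace_span)
    then obtain p d where d: "p \<in> F" "w = p + (\<Sum>i<j. d i *s b (l + i))"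
      by (rule partial_span_split)
    obtain c m where cm: "\<forall>i<j. c i \<in> R" "m \<in> M"
        "w - (\<Sum>i<j. c i *s u i) - epower \<pi> t *s m \<in> F" (is "?q \<in> F")
      using partial_covers w unfolding covers_def by blast
    define r where "r i = inverse (epower \<pi> t) * (d i - c i * epower \<pi> (x i))" for i
    have t_nz: "epower \<pi> t \<noteq> 0"
      using enat uniformizer(1) by simp
    let ?c = "(\<Sum>i<j. c i *s u i) - (\<Sum>i<j. (c i * epower \<pi> (x i)) *s b (l + i))"
    define y where "y = p - ?q - ?c"
    have y: "y \<in> F"
      unfolding y_def
      by (rule subspace_diff[OF partial_subspace_F
            subspace_diff[OF partial_subspace_F d(1) cm(3)] partial_sum_modulo_F])
    have eq: "epower \<pi> t *s m = y + (\<Sum>i<j. (d i - c i * epower \<pi> (x i)) *s b (l + i))"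
      by (simp add: y_def d(2) scale_left_diff_distrib sum_subtractf algebra_simps)
    have "m = inverse (epower \<pi> t) *s (epower \<pi> t *s m)"
      using t_nz by simp
    also have "\<dots> = inverse (epower \<pi> t) *s y + (\<Sum>i<j. r i *s b (l + i))"
      unfolding eq by (simp add: scale_right_distrib scale_sum_right r_def)
    finally have "m = inverse (epower \<pi> t) *s y + (\<Sum>i<j. r i *s b (l + i))" .
    moreover have "inverse (epower \<pi> t) *s y \<in> span (b ` {..<l})"
      unfolding partial_F using y partial_subspace_F by (intro subspace_scale)
    ultimately have r: "r i \<in> R" if "i < j" for i
      using coeff_modulo_span[OF partial_b _ _ that] cm(2) by metis
    have "\<exists>c'. c' \<in> R \<and> d i = c' * epower \<pi> (x i)" if i: "i < j" for i
    proof -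
      obtain s where s: "s \<in> R" "epower \<pi> t = s * epower \<pi> (x i)"
        using epower_mono[OF partial_x[OF i]] .
      have "d i = c i * epower \<pi> (x i) + r i * epower \<pi> t"
        using t_nz by (simp add: r_def field_simps)
      then have "d i = (c i + r i * s) * epower \<pi> (x i)"
        by (simp add: s(2) algebra_simps)
      moreover have "c i + r i * s \<in> R"
        using cm(1) r[OF i] s(1) i by (auto intro!: R_add R_mult)
      ultimately show ?thesis
        by blast
    qed
    then obtain c' where c': "\<And>i. i < j \<Longrightarrow> c' i \<in> R \<and> d i = c' i * epower \<pi> (x i)"
      by metis
    let ?c' = "(\<Sum>i<j. c' i *s u i) - (\<Sum>i<j. (c' i * epower \<pi> (x i)) *s b (l + i))"
    have "(\<Sum>i<j. d i *s b (l + i)) = (\<Sum>i<j. (c' i * epower \<pi> (x i)) *s b (l + i))"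
      using c' by (intro sum.cong) auto
    then have "w - (\<Sum>i<j. c' i *s u i) - epower \<pi> \<infinity> *s 0 = p - ?c'"
      by (simp add: d(2))
    moreover have "p - ?c' \<in> F"
      by (rule subspace_diff[OF partial_subspace_F d(1) partial_sum_modulo_F])
    ultimately show "\<exists>c m. (\<forall>i<j. c i \<in> R) \<and> m \<in> M \<and>
        w - (\<Sum>i<j. c i *s u i) - epower \<pi> \<infinity> *s m \<in> F"
      using c' M_0 by metis
  qed
qed

lemma ex_maximal_cover:
  obtains t' where "t \<le> t'" "covers E F j u t'" "\<And>s. t' = enat s \<Longrightarrow> \<not> covers E F j u (enat (Suc s))"
proof (cases "covers E F j u \<infinity>")
  case True
  then show ?thesis
    using that[of \<infinity>] by simp
next
  case False
  then obtain s where s: "\<not> covers E F j u (enat s)"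
    using covers_infinity by blast
  obtain t0 where t0: "t = enat t0"
    using partial_covers False by (cases t) auto
  have "\<exists>s\<ge>t0. covers E F j u (enat s) \<and> \<not> covers E F j u (enat (Suc s))"
  proof (rule ccontr)
    assume no: "\<not> ?thesis"
    have "covers E F j u (enat (t0 + i))" for i
    proof (induction i)
      case 0
      then show ?case using partial_covers t0 by simp
    next
      case (Suc i)
      then show ?case using no by (metis add_Suc_right le_add1)
    qed
    then have "covers E F j u (enat (t0 + s))" .
    then show False
      using s covers_mono[of E F j u "enat (t0 + s)" "enat s"] by simp
  qed
  then show ?thesis
    using that t0 by (metis enat.inject enat_ord_simps(1))
qed

text \<open>Choose \<open>w\<close> in \<open>E \<inter> M\<close> that is covered to precision \<open>s\<close> but not to precision \<open>s + 1\<close>. Removing its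
  \<open>u\<close>-part leaves \<open>v\<close> with \<open>v \<equiv> \<pi>^s m\<close> modulo \<open>F\<close>. If \<open>m\<close> were in the span of \<open>b\<close> up to \<open>\<pi> M\<close>, then,
  since \<open>s\<close> is at least every \<open>x i\<close>, \<open>w\<close> would be covered to precision \<open>s + 1\<close>. If \<open>v\<close> were in the span
  of \<open>u\<close> up to \<open>\<pi> m'\<close>, then covering \<open>m'\<close> to precision \<open>s\<close> would again put \<open>m\<close> into the span of \<open>b\<close>
  up to \<open>\<pi> M\<close>.\<close>
lemma partial_finite_step:
  assumes E: "subspace E" and "t \<le> enat s" and cov: "covers E F j u (enat s)"
    and not_cov: "\<not> covers E F j u (enat (Suc s))"
  obtains v m where "v \<in> E" "v - epower \<pi> (enat s) *s m \<in> F"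
    "transverse (span (u ` {..<j})) v" "transverse (span (b ` {..<l + j})) m"
proof -
  let ?S = "span (b ` {..<l + j})"
  obtain w where w: "w \<in> E \<inter> M" and
    no: "\<And>c m. \<forall>i<j. c i \<in> R \<Longrightarrow> m \<in> M \<Longrightarrow>
      w - (\<Sum>i<j. c i *s u i) - epower \<pi> (enat (Suc s)) *s m \<notin> F"
    using not_cov unfolding covers_def by blast
  obtain c m where cm: "\<forall>i<j. c i \<in> R" "m \<in> M"
      "w - (\<Sum>i<j. c i *s u i) - epower \<pi> (enat s) *s m \<in> F" (is "?q \<in> F")
    using cov w unfolding covers_def by blast
  define v where "v = w - (\<Sum>i<j. c i *s u i)"
  have v: "v \<in> E" "v \<in> M" "v - \<pi> ^ s *s m \<in> F"
    using w cm E partial_u_E orthonormal_in_M[OF partial_u]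
    by (auto simp: v_def intro!: subspace_diff subspace_sum subspace_scale M_diff M_sum M_scale)
  have m: "transverse ?S m"
    unfolding transverse_def
  proof (intro conjI ballI notI)
    fix p m' assume p: "p \<in> ?S" "m' \<in> M" "m = p + \<pi> *s m'"
    obtain p0 a where a: "p0 \<in> F" "p = p0 + (\<Sum>i<j. a i *s b (l + i))"
      using partial_span_split[OF p(1)] .
    have "p \<in> M"
      using M_diff[OF cm(2) M_scale[OF uniformizer_in_R p(2)]] p(3) by simp
    then have aR: "a i \<in> R" if "i < j" for i
      using coeff_modulo_span[OF partial_b _ _ that] a partial_F by metis
    have "\<exists>r. r \<in> R \<and> \<pi> ^ s = r * epower \<pi> (x i)" if "i < j" for i
      using epower_mono[of "x i" "enat s"] partial_x[OF that] \<open>t \<le> enat s\<close>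
      by (metis epower.simps(1) order_trans)
    then obtain r where r: "\<And>i. i < j \<Longrightarrow> r i \<in> R \<and> \<pi> ^ s = r i * epower \<pi> (x i)"
      by metis
    let ?c' = "(\<Sum>i<j. (a i * r i) *s u i)
      - (\<Sum>i<j. (a i * r i * epower \<pi> (x i)) *s b (l + i))"
    have "\<pi> ^ s *s (\<Sum>i<j. a i *s b (l + i)) = (\<Sum>i<j. (a i * r i * epower \<pi> (x i)) *s b (l + i))"
      unfolding scale_sum_right by (intro sum.cong) (use r in \<open>auto simp: mult_ac\<close>)
    then have "\<pi> ^ s *s m = \<pi> ^ s *s p0 + ((\<Sum>i<j. (a i * r i) *s u i) - ?c') + \<pi> ^ Suc s *s m'"
      by (simp add: p(3) a(2) scale_right_distrib mult.commute)
    then have "w - (\<Sum>i<j. (c i + a i * r i) *s u i) - epower \<pi> (enat (Suc s)) *s m'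
        = ?q + \<pi> ^ s *s p0 - ?c'"
      by (simp add: scale_left_distrib sum.distrib algebra_simps)
    also have "\<dots> \<in> F"
      by (rule subspace_diff[OF partial_subspace_F subspace_add[OF partial_subspace_F cm(3)
              subspace_scale[OF partial_subspace_F a(1)]] partial_sum_modulo_F])
    finally have "w - (\<Sum>i<j. (c i + a i * r i) *s u i) - epower \<pi> (enat (Suc s)) *s m' \<in> F" .
    moreover have "\<forall>i<j. c i + a i * r i \<in> R"
      using cm(1) aR r by (auto intro!: R_add R_mult)
    ultimately show False
      using no[of "\<lambda>i. c i + a i * r i" m'] p(2) by simp
  qed (fact cm(2))
  have "transverse (span (u ` {..<j})) v"
    unfolding transverse_def
  proof (intro conjI ballI notI)
    fix p m' assume p: "p \<in> span (u ` {..<j})" "m' \<in> M" "v = p + \<pi> *s m'"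
    have "p \<in> E"
      using p(1) partial_u_E E span_minimal[of "u ` {..<j}" E] by auto
    then have "inverse \<pi> *s (v - p) \<in> E"
      using v(1) E by (intro subspace_scale subspace_diff)
    then have "m' \<in> E \<inter> M"
      using p uniformizer(1) by simp
    then obtain c' m'' where c': "m'' \<in> M"
        "m' - (\<Sum>i<j. c' i *s u i) - epower \<pi> (enat s) *s m'' \<in> F" (is "?q' \<in> F")
      using cov unfolding covers_def by blast
    have pS: "p \<in> ?S"
      using p(1) partial_u_span span_minimal[of "u ` {..<j}" ?S] by auto
    have "\<pi> ^ s *s (m - \<pi> *s m'')
        = p + \<pi> *s (\<Sum>i<j. c' i *s u i) + \<pi> *s ?q' - (v - \<pi> ^ s *s m)"
      by (simp add: p(3) algebra_simps)
    also have "\<dots> \<in> ?S"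
    proof (rule span_diff[OF span_add[OF span_add[OF pS span_scale] span_scale]])
      show "(\<Sum>i<j. c' i *s u i) \<in> ?S"
        using partial_u_span by (intro span_sum span_scale) auto
    qed (use c'(2) v(3) partial_F_subset in auto)
    finally have "inverse (\<pi> ^ s) *s \<pi> ^ s *s (m - \<pi> *s m'') \<in> ?S"
      by (rule span_scale)
    then have "m - \<pi> *s m'' \<in> ?S"
      using uniformizer(1) by simp
    moreover have "m = (m - \<pi> *s m'') + \<pi> *s m''"
      by simp
    ultimately show False
      using m c'(1) unfolding transverse_def by blast
  qed (fact v(2))
  then show ?thesis
    using that[of v m] v m by simp
qed

text \<open>With exact covering, any new vector of \<open>E\<close> can be corrected by a combination of \<open>u\<close> to lie in \<open>F\<close>.
  Its exponent is infinite, and its partner \<open>m\<close> only has to be transverse.\<close>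
lemma partial_infinite_step:
  assumes E: "subspace E" "j < dim E" and n: "l + j < dim (UNIV :: 'v set)"
    and cov: "covers E F j u \<infinity>"
  obtains v m where "v \<in> E" "v - epower \<pi> \<infinity> *s m \<in> F"
    "transverse (span (u ` {..<j})) v" "transverse (span (b ` {..<l + j})) m"
proof -
  have u_E: "u ` {..<j} \<subseteq> E"
    using partial_u_E by auto
  obtain m where m: "transverse (span (b ` {..<l + j})) m"
    using ex_transverse[OF partial_b, of UNIV] n by auto
  obtain w where w: "w \<in> E" "transverse (span (u ` {..<j})) w"
    using ex_transverse[OF partial_u E(1) u_E] E(2) by auto
  then obtain c m' where c: "\<forall>i<j. c i \<in> R"
      "w - (\<Sum>i<j. c i *s u i) - epower \<pi> \<infinity> *s m' \<in> F"
    using cov unfolding covers_def transverse_def by blast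
  define v where "v = w - (\<Sum>i<j. c i *s u i)"
  have sum: "(\<Sum>i<j. c i *s u i) \<in> span (u ` {..<j})"
    by (intro span_sum span_scale span_base) auto
  have "v \<in> E"
    unfolding v_def using w(1) sum u_E E(1) span_minimal[of "u ` {..<j}" E]
    by (intro subspace_diff) auto
  moreover have "v - epower \<pi> \<infinity> *s m \<in> F"
    using c(2) by (simp add: v_def)
  moreover have "transverse (span (u ` {..<j})) v"
    unfolding transverse_def
  proof (intro conjI ballI notI)
    show "v \<in> M"
      using w(2) c(1) orthonormal_in_M[OF partial_u]
      unfolding v_def transverse_def by (intro M_diff M_sum M_scale) auto
    fix p m' assume p: "p \<in> span (u ` {..<j})" "m' \<in> M" "v = p + \<pi> *s m'"
    then have "w = (p + (\<Sum>i<j. c i *s u i)) + \<pi> *s m'"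
      by (simp add: v_def algebra_simps)
    then show False
      using w(2) p span_add[OF p(1) sum] unfolding transverse_def by blast
  qed
  ultimately show ?thesis
    using that m by blast
qed

lemma partial_position_step:
  assumes E: "subspace E" "j < dim E" and n: "l + j < dim (UNIV :: 'v set)"
  shows "\<exists>b u x t. partial_position E F l (Suc j) b u x t"
proof -
  obtain t' where t': "t \<le> t'" "covers E F j u t'"
      and max: "\<And>s. t' = enat s \<Longrightarrow> \<not> covers E F j u (enat (Suc s))"
    using ex_maximal_cover by blast
  obtain v m where v: "v \<in> E" "v - epower \<pi> t' *s m \<in> F"
      "transverse (span (u ` {..<j})) v" and m: "transverse (span (b ` {..<l + j})) m"
  proof (cases t')
    case (enat s)
    then show ?thesis
      using partial_finite_step[OF E(1), of s] t' max that by blast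
  next
    case infinity
    then show ?thesis
      using partial_infinite_step[OF E n] t'(2) that by blast
  qed
  define b' where "b' = b(l + j := m)"
  define u' where "u' = u(j := v)"
  define x' where "x' = x(j := t')"
  have old: "b' (l + i) = b (l + i)" "u' i = u i" "x' i = x i" if "i < j" for i
    using that by (auto simp: b'_def u'_def x'_def)
  have new: "b' (l + j) = m" "u' j = v" "x' j = t'"
    by (auto simp: b'_def u'_def x'_def)
  have "orthonormal b' {..<l + Suc j}"
    using orthonormal_insert[OF partial_b _ m, of "l + j"] by (simp add: b'_def lessThan_Suc)
  moreover have "orthonormal u' {..<Suc j}"
    using orthonormal_insert[OF partial_u _ v(3), of j] by (simp add: u'_def lessThan_Suc)
  moreover have "span (b' ` {..<l}) = F"
  proof -
    have "b' ` {..<l} = b ` {..<l}"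
      by (auto simp: b'_def)
    then show ?thesis
      by (simp add: partial_F)
  qed
  moreover have "\<forall>i<Suc j. u' i \<in> E \<and> u' i - epower \<pi> (x' i) *s b' (l + i) \<in> F"
    using partial_u_E partial_u_b v(1,2) by (auto simp: less_Suc_eq old new)
  moreover have "\<forall>i<Suc j. x' i \<le> t'"
    using order_trans[OF partial_x t'(1)] by (auto simp: less_Suc_eq old new)
  moreover have "\<forall>i<Suc j. \<forall>i'<i. x' i' \<le> x' i"
  proof (intro allI impI)
    fix i i' assume "i < Suc j" "i' < i"
    then show "x' i' \<le> x' i"
      using order_trans[OF partial_x t'(1)] partial_position
      by (cases "i = j") (auto simp: old new partial_position_def)
  qed
  moreover have "covers E F (Suc j) u' t'"
    unfolding covers_def
  proof
    fix w assume "w \<in> E \<inter> M"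
    then obtain c m' where c: "\<forall>i<j. c i \<in> R" "m' \<in> M"
        "w - (\<Sum>i<j. c i *s u i) - epower \<pi> t' *s m' \<in> F"
      using t'(2) unfolding covers_def by blast
    have "(\<Sum>i<Suc j. (c(j := 0)) i *s u' i) = (\<Sum>i<j. c i *s u i)"
      by (simp add: old)
    then show "\<exists>c m'. (\<forall>i<Suc j. c i \<in> R) \<and> m' \<in> M \<and>
        w - (\<Sum>i<Suc j. c i *s u' i) - epower \<pi> t' *s m' \<in> F"
      using c by (intro exI[of _ "c(j := 0)"] exI[of _ m']) auto
  qed
  ultimately show ?thesis
    unfolding partial_position_def by blast
qed

end

lemma ex_partial_position:
  assumes E: "subspace E" "j \<le> dim E" and F: "subspace F" "dim F = l"
    and n: "l + dim E \<le> dim (UNIV :: 'v set)"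
  shows "\<exists>b u x t. partial_position E F l j b u x t"
  using E(2)
proof (induction j)
  case 0
  have empty: "orthonormal b {}" for b
    by (simp add: orthonormal_def)
  obtain b where b: "orthonormal b {..<l}" "b ` {..<l} \<subseteq> F"
    using orthonormal_extend[OF empty F(1), where J = "{..<l}"] F(2) by auto
  moreover have "span (b ` {..<l}) = F"
    using b F by (intro orthonormal_span) auto
  moreover have "covers E F 0 b 0"
    using subspace_0[OF F(1)] by (auto simp: covers_def intro!: exI)
  ultimately have "partial_position E F l 0 b b (\<lambda>_. 0) 0"
    using empty by (simp add: partial_position_def)
  then show ?case
    by blast
next
  case (Suc j)
  then obtain b u x t where "partial_position E F l j b u x t"
    by auto
  then show ?case
    using E(1) Suc.prems n by (intro partial_position_step) auto
qed

text \<open>The greedy construction leaves \<open>a i = u i - \<pi>^(x i) b (l + i)\<close> in \<open>F\<close>, but these vectors need not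
  belong to a basis of \<open>F\<close>. Where \<open>x i\<close> is positive, \<open>a i\<close> and \<open>u i\<close> agree modulo \<open>\<pi>\<close>, so these
  \<open>a i\<close> inherit orthonormality from the \<open>u i\<close> and extend to an orthonormal basis \<open>e\<close> of \<open>F\<close>. Where
  \<open>x i = 0\<close>, the vector \<open>e i\<close> is arbitrary and \<open>b (l + i)\<close> is replaced by \<open>u i - e i\<close>, which differs
  from it by an element of the lattice of \<open>F\<close>.\<close>
lemma ex_adapted_family:
  assumes E: "subspace E" "dim E = k" and F: "subspace F" "dim F = l"
    and kl: "k \<le> l" "l + k \<le> n" and n: "dim (UNIV :: 'v set) = n"
  obtains b x where "orthonormal b {..<n}" "span (b ` {..<l}) = F"
    "orthonormal (\<lambda>i. b i + epower \<pi> (x i) *s b (l + i)) {..<k}"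
    "span ((\<lambda>i. b i + epower \<pi> (x i) *s b (l + i)) ` {..<k}) = E"
    "\<And>i i'. i' < i \<Longrightarrow> i < k \<Longrightarrow> x i' \<le> (x i :: enat)"
proof -
  obtain b u x t where partial_position: "partial_position E F l k b u x t"
    using ex_partial_position[of E k F l] assms by auto
  note b = partial_b[OF partial_position] and bF = partial_F[OF partial_position]
    and u = partial_u[OF partial_position]
    and uE = partial_u_E[OF partial_position] and ub = partial_u_b[OF partial_position]
  define a where "a i = u i - epower \<pi> (x i) *s b (l + i)" for i
  define J where "J = {i. i < k \<and> x i \<noteq> 0}"
  have J: "finite J" "J \<subseteq> {..<k}"
    by (auto simp: J_def)
  have aF: "a i \<in> F" if "i < k" for i
    using ub[OF that] by (simp add: a_def)
  have aM: "a i \<in> M" if "i < k" for i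
    unfolding a_def using that orthonormal_in_M[OF u] orthonormal_in_M[OF b]
    by (intro M_diff M_scale) auto
  have "orthonormal a J"
  proof (rule orthonormalI)
    fix c i assume c: "(\<Sum>i\<in>J. c i *s a i) \<in> M" and i: "i \<in> J"
    show "c i \<in> R"
    proof (rule ccontr)
      assume ci: "c i \<notin> R"
      then have "c i \<noteq> 0"
        by auto
      then obtain d j where d: "j \<in> J" "absv (d * c j) = 1" "\<And>i. i \<in> J \<Longrightarrow> d * c i \<in> R"
        using ex_scale_to_unit[of J i c, OF J(1) i] by blast
      obtain r where r: "r \<in> R" "inverse (c i) = \<pi> * r"
        using inverse_of_nonintegral[OF ci] .
      \<comment> \<open>The scaling factor is \<open>d / \<pi>\<close>: it makes the largest coefficient just fail to be integral,
        but a positive exponent brings every \<open>b\<close>-coefficient back into \<open>R\<close>.\<close>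
      define r' where "r' = d * c i * r"
      have r': "r' \<in> R" "d = \<pi> * r'"
      proof -
        show "r' \<in> R"
          unfolding r'_def using R_mult[OF d(3)[OF i] r(1)] .
        have "d = d * c i * inverse (c i)"
          using \<open>c i \<noteq> 0\<close> by simp
        then show "d = \<pi> * r'"
          by (simp add: r(2) r'_def mult_ac)
      qed
      have "r' * c j * epower \<pi> (x j) \<in> R" if "j \<in> J" for j
      proof -
        have "1 \<le> x j"
          using that by (cases "x j") (auto simp: J_def one_enat_def zero_enat_def)
        then obtain s where s: "s \<in> R" "epower \<pi> (x j) = s * epower \<pi> 1"
          by (rule epower_mono)
        then have "r' * c j * epower \<pi> (x j) = s * (d * c j)"
          by (simp add: r'(2) one_enat_def)
        then show ?thesis
          using R_mult[OF s(1) d(3)[OF that]] by (simp only:)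
      qed
      then have "(\<Sum>i\<in>J. (r' * c i * epower \<pi> (x i)) *s b (l + i)) \<in> M"
        using J(2) orthonormal_in_M[OF b] by (intro M_sum M_scale) auto
      then have "r' *s (\<Sum>i\<in>J. c i *s a i) + (\<Sum>i\<in>J. (r' * c i * epower \<pi> (x i)) *s b (l + i)) \<in> M"
        by (intro M_add M_scale r' c)
      also have "r' *s (\<Sum>i\<in>J. c i *s a i) + (\<Sum>i\<in>J. (r' * c i * epower \<pi> (x i)) *s b (l + i))
          = (\<Sum>i\<in>J. (r' * c i) *s u i)"
        by (simp add: a_def scale_sum_right scale_right_diff_distrib mult.assoc flip: sum.distrib)
      finally have "r' * c j \<in> R"
        using orthonormal_coeff[OF orthonormal_subset[OF u J(2)]] d(1) by metis
      then have "absv \<pi> * absv (r' * c j) \<le> absv \<pi>"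
        using absv_uniformizer_pos by (simp add: R_iff)
      moreover have "absv \<pi> * absv (r' * c j) = 1"
        using d(2) by (simp add: r'(2) mult.assoc flip: absv_mult)
      ultimately show False
        using absv_uniformizer_less_1 by simp
    qed
  qed (use J aM in auto)
  moreover have "a ` J \<subseteq> F" "J \<subseteq> {..<l}" "card {..<l} \<le> dim F"
    using J(2) aF kl(1) F(2) by auto
  ultimately obtain e where e: "orthonormal e {..<l}" "e ` {..<l} \<subseteq> F" "\<And>i. i \<in> J \<Longrightarrow> e i = a i"
    using orthonormal_extend[OF _ F(1)] by (metis finite_lessThan)
  have eF: "span (e ` {..<l}) = F"
    using e F by (intro orthonormal_span) auto
  define f where "f i = (if i \<in> J then b (l + i) else u i - e i)" for i
  have f_b: "f i - b (l + i) \<in> F \<inter> M" if "i < k" for i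
  proof (cases "i \<in> J")
    case False
    then have "f i - b (l + i) = a i - e i"
      using that by (simp add: f_def a_def J_def)
    moreover have "e i \<in> F \<inter> M"
      using that kl(1) e(2) orthonormal_in_M[OF e(1)] by auto
    ultimately show ?thesis
      using aF[OF that] aM[OF that] subspace_diff[OF F(1)] M_diff by auto
  qed (simp add: f_def subspace_0[OF F(1)])
  define b0 where "b0 i = (if i < l then e i else f (i - l))" for i
  have split: "(\<Sum>i<l + k. c i *s b0 i) = (\<Sum>i<l. c i *s e i) + (\<Sum>i<k. c (l + i) *s f i)" for c
    by (simp add: sum_lessThan_add b0_def)
  have fM: "f i \<in> M" if "i < k" for i
    using M_add[of "f i - b (l + i)" "b (l + i)"] f_b[OF that] orthonormal_in_M[OF b] that by simp
  have "orthonormal b0 {..<l + k}"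
  proof (rule orthonormalI)
    show "b0 i \<in> M" if "i \<in> {..<l + k}" for i
      using that fM orthonormal_in_M[OF e(1)] by (auto simp: b0_def)
    fix c i assume c: "(\<Sum>i<l + k. c i *s b0 i) \<in> M" and i: "i \<in> {..<l + k}"
    let ?p = "(\<Sum>i<l. c i *s e i) + (\<Sum>i<k. c (l + i) *s (f i - b (l + i)))"
    have "?p \<in> F"
      using e(2) f_b F(1) by (intro subspace_add subspace_sum subspace_scale) auto
    moreover have "(\<Sum>i<l + k. c i *s b0 i) = ?p + (\<Sum>i<k. c (l + i) *s b (l + i))"
      by (simp add: split scale_right_diff_distrib sum_subtractf)
    ultimately have cf: "c (l + i) \<in> R" if "i < k" for i
      using coeff_modulo_span[OF b, of ?p "\<lambda>i. c (l + i)"] c bF that by simp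
    have "(\<Sum>i<k. c (l + i) *s f i) \<in> M"
      using cf fM by (intro M_sum M_scale) auto
    from M_diff[OF c this] have "(\<Sum>i<l + k. c i *s b0 i) - (\<Sum>i<k. c (l + i) *s f i) \<in> M" .
    then have "(\<Sum>i<l. c i *s e i) \<in> M"
      by (simp add: split)
    then have ce: "c i \<in> R" if "i < l" for i
      using orthonormal_coeff[OF e(1)] that by auto
    show "c i \<in> R"
      using ce[of i] cf[of "i - l"] i by (cases "i < l") auto
  qed auto
  then obtain b' where b': "orthonormal b' {..<n}" "\<And>i. i < l + k \<Longrightarrow> b' i = b0 i"
    using orthonormal_extend[of b0 "{..<l + k}" UNIV "{..<n}"] n kl by auto
  have u_eq: "b' i + epower \<pi> (x i) *s b' (l + i) = u i" if "i < k" for i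
    using that kl e(3)
    by (auto simp: b'(2) b0_def f_def a_def J_def)
  show ?thesis
  proof (rule that[of b' x])
    have "b' ` {..<l} = e ` {..<l}"
      by (intro image_cong) (auto simp: b'(2) b0_def)
    then show "span (b' ` {..<l}) = F"
      by (simp add: eF)
    show "orthonormal (\<lambda>i. b' i + epower \<pi> (x i) *s b' (l + i)) {..<k}"
      by (rule iffD1[OF orthonormal_cong u]) (simp add: u_eq)
    have "(\<lambda>i. b' i + epower \<pi> (x i) *s b' (l + i)) ` {..<k} = u ` {..<k}"
      by (intro image_cong) (auto simp: u_eq)
    moreover have "span (u ` {..<k}) = E"
      using uE E by (intro orthonormal_span[OF u]) auto
    ultimately show "span ((\<lambda>i. b' i + epower \<pi> (x i) *s b' (l + i)) ` {..<k}) = E"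
      by simp
    show "x i' \<le> x i" if "i' < i" "i < k" for i i'
      using partial_position that unfolding partial_position_def by blast
  qed (fact b'(1))
qed

end

section \<open>Invariance of the singular values\<close>

context nonarch_local_field
begin

lemma R_basis_ex_coeff:
  "R_basis absv scl M bs \<Longrightarrow> x \<in> M \<Longrightarrow>
    \<exists>c. (\<forall>i<length bs. c i \<in> R) \<and> x = (\<Sum>i<length bs. scl (c i) (bs ! i))"
  by (simp add: R_basis_def)

lemma R_basis_nth_mem: "R_basis absv scl M bs \<Longrightarrow> i < length bs \<Longrightarrow> bs ! i \<in> M"
  using nth_mem[of i bs] by (auto simp: R_basis_def)

lemma R_basis_zero_coeff:
  assumes vs: "vector_space scl" and bs: "R_basis absv scl M bs"
    and I: "I \<subseteq> {..<length bs}" and sum: "(\<Sum>i\<in>I. scl (c i) (bs ! i)) = 0" and i: "i \<in> I"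
  shows "c i = 0"
proof (rule ccontr)
  interpret vector_space scl by fact
  assume "c i \<noteq> 0"
  moreover have "finite I"
    using I finite_subset by blast
  ultimately obtain d j where d: "j \<in> I" "absv (d * c j) = 1" "\<And>i. i \<in> I \<Longrightarrow> d * c i \<in> R"
    using ex_scale_to_unit[of I i c] i by blast
  define c' where "c' i = (if i \<in> I then d * c i else 0)" for i
  have "(\<Sum>i<length bs. scl (c' i) (bs ! i)) = (\<Sum>i\<in>I. scl (c' i) (bs ! i))"
    using I by (intro sum.mono_neutral_right) (auto simp: c'_def)
  also have "\<dots> = scl d (\<Sum>i\<in>I. scl (c i) (bs ! i))"
    by (simp add: c'_def scale_sum_right)
  finally have "(\<Sum>i<length bs. scl (c' i) (bs ! i)) = 0"
    using sum by simp
  moreover have "\<forall>i<length bs. c' i \<in> R"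
    using d(3) by (simp add: c'_def)
  ultimately have "c' j = 0"
    using bs d(1) I unfolding R_basis_def by blast
  then have "d * c j = 0"
    using d(1) by (simp add: c'_def)
  then show False
    using d(2) by (simp only: absv_zero zero_neq_one)
qed

text \<open>The sums range over subsets \<open>I\<close> because the min-max argument below combines only an initial segment
  of \<open>bs\<close>.\<close>
lemma R_basis_transition:
  assumes vs: "vector_space scl" and bs: "R_basis absv scl M bs" and cs: "R_basis absv scl M cs"
  shows "\<exists>a. (\<forall>r<length cs. \<forall>j<length bs. a r j \<in> R) \<and>
    (\<forall>v. \<forall>I\<subseteq>{..<length bs}. (\<Sum>j\<in>I. scl (v j) (bs ! j))
      = (\<Sum>r<length cs. scl (\<Sum>j\<in>I. a r j * v j) (cs ! r)))"
proof -
  interpret vector_space scl by fact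
  have "\<exists>c. (\<forall>r<length cs. c r \<in> R) \<and> bs ! j = (\<Sum>r<length cs. scl (c r) (cs ! r))"
    if "j < length bs" for j
    using R_basis_ex_coeff[OF cs R_basis_nth_mem[OF bs that]] .
  then obtain a where a: "\<And>j. j < length bs \<Longrightarrow>
      (\<forall>r<length cs. a j r \<in> R) \<and> bs ! j = (\<Sum>r<length cs. scl (a j r) (cs ! r))"
    by metis
  show ?thesis
  proof (intro exI[of _ "\<lambda>r j. a j r"] conjI allI impI)
    fix v I assume I: "I \<subseteq> {..<length bs}"
    have "(\<Sum>j\<in>I. scl (v j) (bs ! j)) = (\<Sum>j\<in>I. \<Sum>r<length cs. scl (a j r * v j) (cs ! r))"
    proof (rule sum.cong)
      fix j assume "j \<in> I"
      then have "bs ! j = (\<Sum>r<length cs. scl (a j r) (cs ! r))"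
        using a I by auto
      then show "scl (v j) (bs ! j) = (\<Sum>r<length cs. scl (a j r * v j) (cs ! r))"
        by (simp add: scale_sum_right mult.commute)
    qed simp
    also have "\<dots> = (\<Sum>r<length cs. scl (\<Sum>j\<in>I. a j r * v j) (cs ! r))"
      unfolding scale_sum_left by (rule sum.swap)
    finally show "(\<Sum>j\<in>I. scl (v j) (bs ! j)) = (\<Sum>r<length cs. scl (\<Sum>j\<in>I. a j r * v j) (cs ! r))" .
  qed (use a in blast)
qed

lemma R_basis_length_le:
  assumes vs: "vector_space scl" and bs: "R_basis absv scl M bs" and cs: "R_basis absv scl M cs"
  shows "length bs \<le> length cs"
proof (rule ccontr)
  interpret vector_space scl by fact
  assume "\<not> ?thesis"
  then have less: "{..length cs} \<subseteq> {..<length bs}"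
    by auto
  from R_basis_transition[OF vs bs cs] obtain a where a: "\<forall>v. \<forall>I\<subseteq>{..<length bs}.
      (\<Sum>j\<in>I. scl (v j) (bs ! j)) = (\<Sum>r<length cs. scl (\<Sum>j\<in>I. a r j * v j) (cs ! r))"
    by (elim exE conjE)
  from ex_kernel_vector[of "length cs" a] obtain v j where v: "j \<le> length cs" "absv (v j) = 1"
      "\<forall>r<length cs. (\<Sum>i\<le>length cs. a r i * v i) = 0"
    by (elim exE conjE)
  have "(\<Sum>j\<le>length cs. scl (v j) (bs ! j)) = 0"
    using a less v(3) by simp
  then have "v j = 0"
    using R_basis_zero_coeff[OF vs bs less] v(1) by simp
  then show False
    using v(2) by simp
qed

text \<open>The Courant--Fischer argument. Among the combinations of the first \<open>i + 1\<close> vectors of \<open>bs\<close> there is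
  a vector \<open>w\<close> of norm 1 whose first \<open>i\<close> coordinates in \<open>bs'\<close> vanish. By the second diagonal form
  \<open>T w\<close> has norm at most that of \<open>d' i\<close>; by the first one its norm is at least that of \<open>d i\<close>.\<close>
lemma diagonal_absv_le:
  assumes vs1: "vector_space s1" and vs2: "vector_space s2" and T: "Vector_Spaces.linear s1 s2 T"
    and N: "R_submodule absv s2 N"
    and bs: "R_basis absv s1 M bs" and cs: "R_basis absv s2 N cs"
    and Tb: "\<And>j. j < length bs \<Longrightarrow> T (bs ! j) = s2 (d j) (cs ! j)"
    and d: "\<And>i j. i \<le> j \<Longrightarrow> j < length bs \<Longrightarrow> \<exists>t\<in>R. d j = t * d i"
    and bs': "R_basis absv s1 M bs'" and cs': "R_basis absv s2 N cs'"
    and Tb': "\<And>j. j < length bs' \<Longrightarrow> T (bs' ! j) = s2 (d' j) (cs' ! j)"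
    and d': "\<And>i j. i \<le> j \<Longrightarrow> j < length bs' \<Longrightarrow> \<exists>t\<in>R. d' j = t * d' i"
    and d'0: "\<And>j. length cs' \<le> j \<Longrightarrow> d' j = 0"
    and i: "i < length bs" "i < length cs"
  shows "absv (d i) \<le> absv (d' i)"
proof -
  interpret v1: vector_space s1 by fact
  interpret v2: vector_space s2 by fact
  interpret T: Vector_Spaces.linear s1 s2 T by fact
  have less: "{..i} \<subseteq> {..<length bs}" "{..i} \<subseteq> {..<length cs}"
    using i by auto
  from R_basis_transition[OF vs1 bs bs'] obtain a where
    aR: "\<forall>r<length bs'. \<forall>j<length bs. a r j \<in> R" and
    a: "\<forall>v. \<forall>I\<subseteq>{..<length bs}.
      (\<Sum>j\<in>I. s1 (v j) (bs ! j)) = (\<Sum>r<length bs'. s1 (\<Sum>j\<in>I. a r j * v j) (bs' ! r))"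
    by (elim exE conjE)
  from ex_kernel_vector[of i a] obtain v j where v: "j \<le> i" "absv (v j) = 1"
      "\<forall>j\<le>i. v j \<in> R" "\<forall>r<i. (\<Sum>j\<le>i. a r j * v j) = 0"
    by (elim exE conjE)
  define y where "y r = (\<Sum>j\<le>i. a r j * v j)" for r
  have yR: "y r \<in> R" if "r < length bs'" for r
    unfolding y_def using aR v(3) that i by (intro R_sum R_mult) auto
  have "\<exists>z. z \<in> R \<and> (length cs' \<le> r \<longrightarrow> z = 0) \<and> y r * d' r = d' i * z" if r: "r < length bs'" for r
  proof -
    consider "r < i" | "length cs' \<le> r" | "i \<le> r" "r < length cs'"
      by linarith
    then show ?thesis
    proof cases
      case 1
      then show ?thesis
        using v(4) by (intro exI[of _ 0]) (simp add: y_def)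
    next
      case 2
      then show ?thesis
        using d'0 by (intro exI[of _ 0]) simp
    next
      case 3
      then obtain t where t: "t \<in> R" "d' r = t * d' i"
        using d'[of i r] r by auto
      have "y r * d' r = d' i * (y r * t)"
        by (simp add: t(2) mult_ac)
      then show ?thesis
        using 3 R_mult[OF yR[OF r] t(1)] by (intro exI[of _ "y r * t"]) simp
    qed
  qed
  then obtain z where z: "\<And>r. r < length bs' \<Longrightarrow>
      z r \<in> R \<and> (length cs' \<le> r \<longrightarrow> z r = 0) \<and> y r * d' r = d' i * z r"
    by metis
  define x where "x = (\<Sum>r<length bs'. s2 (z r) (cs' ! r))"
  have N_sum: "(\<And>r. r \<in> K \<Longrightarrow> f r \<in> N) \<Longrightarrow> sum f K \<in> N" for f and K :: "nat set"
    using N by (induction K rule: infinite_finite_induct) (auto simp: R_submodule_def)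
  have "s2 (z r) (cs' ! r) \<in> N" if "r < length bs'" for r
  proof (cases "r < length cs'")
    case True
    then show ?thesis
      using z[OF that] N R_basis_nth_mem[OF cs' True] by (simp add: R_submodule_def)
  next
    case False
    then show ?thesis
      using z[OF that] N by (simp add: R_submodule_def)
  qed
  then have "x \<in> N"
    unfolding x_def by (intro N_sum) auto
  from R_basis_ex_coeff[OF cs this] obtain e
    where e: "\<forall>s<length cs. e s \<in> R" "x = (\<Sum>s<length cs. s2 (e s) (cs ! s))"
    by (elim exE conjE)
  have "(\<Sum>j\<le>i. s2 (v j * d j) (cs ! j)) = T (\<Sum>j\<le>i. s1 (v j) (bs ! j))"
    unfolding T.sum T.scale using less(1) Tb by (intro sum.cong) auto
  also have "\<dots> = T (\<Sum>r<length bs'. s1 (y r) (bs' ! r))"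
    using a less(1) by (simp add: y_def)
  also have "\<dots> = (\<Sum>r<length bs'. s2 (d' i * z r) (cs' ! r))"
    unfolding T.sum T.scale using Tb' z by (intro sum.cong) auto
  also have "\<dots> = s2 (d' i) x"
    by (simp add: x_def v2.scale_sum_right)
  also have "\<dots> = (\<Sum>s<length cs. s2 (d' i * e s) (cs ! s))"
    by (simp add: e(2) v2.scale_sum_right)
  finally have eq: "(\<Sum>j\<le>i. s2 (v j * d j) (cs ! j)) = (\<Sum>s<length cs. s2 (d' i * e s) (cs ! s))" .
  have "(\<Sum>j\<le>i. s2 (v j * d j) (cs ! j))
      = (\<Sum>s<length cs. s2 (if s \<le> i then v s * d s else 0) (cs ! s))"
    using less(2) by (intro sum.mono_neutral_cong_left) auto
  with eq have "(\<Sum>s<length cs. s2 ((if s \<le> i then v s * d s else 0) - d' i * e s) (cs ! s)) = 0"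
    by (simp add: v2.scale_left_diff_distrib sum_subtractf)
  from R_basis_zero_coeff[OF vs2 cs order_refl this, of j] have "v j * d j = d' i * e j"
    using v(1) i by simp
  then have "absv (v j) * absv (d j) = absv (d' i) * absv (e j)"
    by (metis absv_mult)
  moreover have "absv (e j) \<le> 1"
    using e(1) v(1) i by (simp add: R_iff)
  ultimately have "absv (d j) \<le> absv (d' i)"
    using v(2) absv_nonneg[of "d' i"] absv_nonneg[of "e j"] by (simp add: mult_left_le)
  moreover obtain t where "t \<in> R" "d i = t * d j"
    using d[OF v(1) i(1)] by blast
  then have "absv (d i) \<le> absv (d j)"
    by (simp add: R_iff absv_mult absv_nonneg mult_left_le_one_le)
  ultimately show ?thesis
    by simp
qed

definition transform :: "('k \<Rightarrow> 'v::ab_group_add \<Rightarrow> 'v) \<Rightarrow> 'v list \<Rightarrow> 'k mat \<Rightarrow> 'v list"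
  where "transform scl bs Q =
    map (\<lambda>j. \<Sum>i<length bs. scl (Q $$ (i, j)) (bs ! i)) [0..<length bs]"

lemma length_transform [simp]: "length (transform scl bs Q) = length bs"
  by (simp add: transform_def)

lemma transform_nth:
  "j < length bs \<Longrightarrow> transform scl bs Q ! j = (\<Sum>i<length bs. scl (Q $$ (i, j)) (bs ! i))"
  by (simp add: transform_def)

lemma sum_transform:
  assumes "vector_space scl"
  shows "(\<Sum>j<length bs. scl (c j) (transform scl bs Q ! j))
    = (\<Sum>i<length bs. scl (\<Sum>j<length bs. Q $$ (i, j) * c j) (bs ! i))"
proof -
  interpret vector_space scl by fact
  have "(\<Sum>j<length bs. scl (c j) (transform scl bs Q ! j))
      = (\<Sum>j<length bs. \<Sum>i<length bs. scl (Q $$ (i, j) * c j) (bs ! i))"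
    by (intro sum.cong) (auto simp: transform_nth scale_sum_right mult.commute)
  also have "\<dots> = (\<Sum>i<length bs. scl (\<Sum>j<length bs. Q $$ (i, j) * c j) (bs ! i))"
    unfolding scale_sum_left by (rule sum.swap)
  finally show ?thesis .
qed

lemma sum_inverse_mat:
  assumes P: "P \<in> carrier_mat m m" and Q: "Q \<in> carrier_mat m m" and PQ: "inverts_mat P Q"
    and "i < m"
  shows "(\<Sum>j<m. P $$ (i, j) * (\<Sum>r<m. Q $$ (j, r) * c r)) = c i"
proof -
  have entry: "(\<Sum>j<m. P $$ (i, j) * Q $$ (j, r)) = (if i = r then 1 else 0)" if "r < m" for r
  proof -
    have "(P * Q) $$ (i, r) = (1\<^sub>m m) $$ (i, r)"
      using PQ P by (simp add: inverts_mat_def)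
    then show ?thesis
      using P Q that \<open>i < m\<close> by (simp add: scalar_prod_def atLeast0LessThan)
  qed
  have "(\<Sum>j<m. P $$ (i, j) * (\<Sum>r<m. Q $$ (j, r) * c r))
      = (\<Sum>r<m. (\<Sum>j<m. P $$ (i, j) * Q $$ (j, r)) * c r)"
    unfolding sum_distrib_left sum_distrib_right mult.assoc by (rule sum.swap)
  also have "\<dots> = (\<Sum>r<m. if i = r then c r else 0)"
    by (intro sum.cong) (auto simp: entry)
  also have "\<dots> = c i"
    using \<open>i < m\<close> by simp
  finally show ?thesis .
qed

lemma R_basis_transform:
  assumes vs: "vector_space scl" and M: "R_submodule absv scl M" and bs: "R_basis absv scl M bs"
    and Q: "Q \<in> GL_R absv (length bs)"
  shows "R_basis absv scl M (transform scl bs Q)"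
proof -
  interpret vector_space scl by fact
  let ?m = "length bs"
  obtain P where P: "P \<in> carrier_mat ?m ?m" "elements_mat P \<subseteq> R" "inverts_mat Q P" "inverts_mat P Q"
    and Qc: "Q \<in> carrier_mat ?m ?m" "elements_mat Q \<subseteq> R"
    using Q by (auto simp: GL_R_def)
  have PR: "P $$ (i, j) \<in> R" and QR: "Q $$ (i, j) \<in> R" if "i < ?m" "j < ?m" for i j
    using that P(1,2) Qc by (blast intro: elements_matI)+
  have M_sum: "(\<And>r. r \<in> K \<Longrightarrow> f r \<in> M) \<Longrightarrow> sum f K \<in> M" for f and K :: "nat set"
    using M by (induction K rule: infinite_finite_induct) (auto simp: R_submodule_def)
  have "transform scl bs Q ! j \<in> M" if "j < ?m" for j
  proof -
    have "scl (Q $$ (i, j)) (bs ! i) \<in> M" if "i < ?m" for i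
      using M QR[OF that \<open>j < ?m\<close>] R_basis_nth_mem[OF bs that] unfolding R_submodule_def by blast
    then show ?thesis
      unfolding transform_nth[OF that] by (intro M_sum) auto
  qed
  then have sub: "set (transform scl bs Q) \<subseteq> M"
    by (auto simp: in_set_conv_nth)
  show ?thesis
    unfolding R_basis_def length_transform
  proof (intro conjI ballI allI impI)
    fix x assume "x \<in> M"
    from R_basis_ex_coeff[OF bs this] obtain c
      where c: "\<forall>i<?m. c i \<in> R" "x = (\<Sum>i<?m. scl (c i) (bs ! i))"
      by (elim exE conjE)
    have "x = (\<Sum>j<?m. scl (\<Sum>r<?m. P $$ (j, r) * c r) (transform scl bs Q ! j))"
      unfolding sum_transform[OF vs] c(2)
      by (intro sum.cong) (auto simp: sum_inverse_mat[OF Qc(1) P(1,3)])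
    moreover have "\<forall>j<?m. (\<Sum>r<?m. P $$ (j, r) * c r) \<in> R"
      using PR c(1) by (auto intro!: R_sum R_mult)
    ultimately show "\<exists>c. (\<forall>j<?m. c j \<in> R) \<and> x = (\<Sum>j<?m. scl (c j) (transform scl bs Q ! j))"
      by (intro exI[of _ "\<lambda>j. \<Sum>r<?m. P $$ (j, r) * c r"] conjI)
  next
    fix c j assume c: "(\<Sum>j<?m. scl (c j) (transform scl bs Q ! j)) = 0" and j: "j < ?m"
    have "(\<Sum>r<?m. Q $$ (i, r) * c r) = 0" if "i < ?m" for i
      using R_basis_zero_coeff[OF vs bs order_refl c[unfolded sum_transform[OF vs]], of i] that by simp
    then show "c j = 0"
      using sum_inverse_mat[OF P(1) Qc(1) P(4) j, of c] by simp
  qed (fact sub)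
qed

text \<open>The matrices of a Smith normal form are changes of basis, after which \<open>T\<close> maps the \<open>j\<close>-th basis
  vector to a multiple of the \<open>j\<close>-th one. A domain basis longer than the codomain basis is handled
  by the factor 0 in front of an unspecified list entry.\<close>
lemma smith_normal_form_bases:
  assumes vs1: "vector_space s1" and vs2: "vector_space s2" and T: "Vector_Spaces.linear s1 s2 T"
    and M: "R_submodule absv s1 M" and N: "R_submodule absv s2 N"
    and bs: "R_basis absv s1 M bs" and cs: "R_basis absv s2 N cs"
    and A: "matrix_of s2 T bs cs A" and D: "smith_normal_form absv A D"
  obtains bs' cs' where "R_basis absv s1 M bs'" "R_basis absv s2 N cs'"
    "length bs' = dim_col D" "length cs' = dim_row D"
    "dim_col D = length bs" "dim_row D = length cs"
    "\<And>j. j < length bs \<Longrightarrow>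
      T (bs' ! j) = s2 (if j < length cs then D $$ (j, j) else 0) (cs' ! j)"
proof -
  interpret v1: vector_space s1 by fact
  interpret v2: vector_space s2 by fact
  interpret T: Vector_Spaces.linear s1 s2 T by fact
  let ?m = "length bs" and ?n = "length cs"
  have Ac: "A \<in> carrier_mat ?n ?m" and
    TA: "\<And>j. j < ?m \<Longrightarrow> T (bs ! j) = (\<Sum>i<?n. s2 (A $$ (i, j)) (cs ! i))"
    using A by (auto simp: matrix_of_def)
  obtain P Q where P: "P \<in> GL_R absv ?n" and Q: "Q \<in> GL_R absv ?m" and D_eq: "D = P * A * Q"
    and diag: "diagonal_mat D"
    using D Ac unfolding smith_normal_form_def by auto
  obtain P' where P': "P' \<in> GL_R absv ?n" "P' \<in> carrier_mat ?n ?n" "inverts_mat P' P"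
    and Pc: "P \<in> carrier_mat ?n ?n"
    using P unfolding GL_R_def by blast
  have Qc: "Q \<in> carrier_mat ?m ?m"
    using Q by (simp add: GL_R_def)
  have Dc: "D \<in> carrier_mat ?n ?m"
    using D_eq Pc Ac Qc by simp
  have "P' * D = (P' * P) * (A * Q)"
    unfolding D_eq using P'(2) Pc Ac Qc
    by (simp add: assoc_mult_mat[of _ ?n ?n _ ?n _ ?m] assoc_mult_mat[of _ ?n ?n _ ?m _ ?m])
  also have "\<dots> = A * Q"
    using P'(2,3) Ac Qc by (simp add: inverts_mat_def)
  finally have PD: "P' * D = A * Q" .
  define d where "d j = (if j < ?n then D $$ (j, j) else 0)" for j
  have "T (transform s1 bs Q ! j) = s2 (d j) (transform s2 cs P' ! j)" if j: "j < ?m" for j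
  proof -
    have "T (transform s1 bs Q ! j) = (\<Sum>i<?m. \<Sum>r<?n. s2 (A $$ (r, i) * Q $$ (i, j)) (cs ! r))"
      by (simp add: transform_nth[OF j] T.sum T.scale TA v2.scale_sum_right mult.commute)
    also have "\<dots> = (\<Sum>r<?n. s2 (\<Sum>i<?m. A $$ (r, i) * Q $$ (i, j)) (cs ! r))"
      unfolding v2.scale_sum_left by (rule sum.swap)
    also have "\<dots> = (\<Sum>r<?n. s2 ((P' * D) $$ (r, j)) (cs ! r))"
      unfolding PD using Ac Qc j
      by (intro sum.cong) (auto simp: scalar_prod_def atLeast0LessThan)
    also have "\<dots> = (\<Sum>r<?n. s2 (P' $$ (r, j) * d j) (cs ! r))"
    proof (intro sum.cong arg_cong2[of _ _ _ _ s2] refl)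
      fix r assume "r \<in> {..<?n}"
      then have "(P' * D) $$ (r, j) = (\<Sum>s<?n. P' $$ (r, s) * D $$ (s, j))"
        using P'(2) Dc j by (simp add: scalar_prod_def atLeast0LessThan)
      also have "\<dots> = (\<Sum>s<?n. if s = j then P' $$ (r, j) * D $$ (j, j) else 0)"
        using diag Dc j by (intro sum.cong) (auto simp: diagonal_mat_def)
      also have "\<dots> = P' $$ (r, j) * d j"
        by (simp add: d_def)
      finally show "(P' * D) $$ (r, j) = P' $$ (r, j) * d j" .
    qed
    also have "\<dots> = s2 (d j) (transform s2 cs P' ! j)"
    proof (cases "j < ?n")
      case True
      then show ?thesis
        by (simp add: transform_nth v2.scale_sum_right mult.commute)
    qed (simp add: d_def)
    finally show ?thesis .
  qed
  then show ?thesis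
    using that[of "transform s1 bs Q" "transform s2 cs P'"] Dc
      R_basis_transform[OF vs1 M bs Q] R_basis_transform[OF vs2 N cs P'(1)]
    by (simp add: d_def)
qed

lemma divides_chain:
  assumes "\<And>i. Suc i < m \<Longrightarrow> \<exists>r\<in>R. d (Suc i) = r * d i" and "i \<le> j" "j < m"
  shows "\<exists>t\<in>R. d j = t * d i"
  using assms(2,3)
proof (induction j rule: dec_induct)
  case base
  show ?case
    by (intro bexI[of _ 1]) auto
next
  case (step j)
  then obtain t r where "t \<in> R" "d j = t * d i" "r \<in> R" "d (Suc j) = r * d j"
    using assms(1)[of j] by auto
  then show ?case
    by (intro bexI[of _ "r * t"]) (auto intro: R_mult)
qed

lemma one_in_GL_R: "1\<^sub>m m \<in> GL_R absv m"
proof -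
  have "elements_mat (1\<^sub>m m) \<subseteq> R"
    by (auto simp: elements_mat_def one_mat_def)
  then show ?thesis
    by (auto simp: GL_R_def inverts_mat_def)
qed

text \<open>Diagonal data is its own Smith normal form, and any other one has the same absolute values by
  \<open>diagonal_absv_le\<close> applied in both directions.\<close>
lemma singular_values_diagonal:
  assumes vs1: "vector_space s1" and vs2: "vector_space s2" and T: "Vector_Spaces.linear s1 s2 T"
    and M: "R_submodule absv s1 M" and N: "R_submodule absv s2 N"
    and bs: "R_basis absv s1 M bs" and cs: "R_basis absv s2 N cs"
    and len: "length bs \<le> length cs"
    and Tb: "\<And>j. j < length bs \<Longrightarrow> T (bs ! j) = s2 (d j) (cs ! j)"
    and d: "\<And>i. Suc i < length bs \<Longrightarrow> \<exists>r\<in>R. d (Suc i) = r * d i"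
  shows "singular_values absv s1 M s2 N T = map (\<lambda>i. absv (d i)) [0..<length bs]"
  unfolding singular_values_def
proof (rule the_equality)
  interpret v2: vector_space s2 by fact
  let ?m = "length bs" and ?n = "length cs"
  let ?D = "mat ?n ?m (\<lambda>(i, j). if i = j then d j else 0)"
  have "T (bs ! j) = (\<Sum>i<?n. s2 (?D $$ (i, j)) (cs ! i))" if j: "j < ?m" for j
  proof -
    have "(\<Sum>i<?n. s2 (?D $$ (i, j)) (cs ! i)) = (\<Sum>i<?n. if i = j then s2 (d j) (cs ! j) else 0)"
      using j by (intro sum.cong) auto
    then show ?thesis
      using j len by (simp add: Tb)
  qed
  then have "matrix_of s2 T bs cs ?D"
    by (simp add: matrix_of_def)
  moreover have "smith_normal_form absv ?D ?D"
    unfolding smith_normal_form_def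
  proof (intro conjI bexI)
    show "?D = 1\<^sub>m (dim_row ?D) * ?D * 1\<^sub>m (dim_col ?D)"
      by simp
    show "diagonal_mat ?D"
      by (auto simp: diagonal_mat_def)
    show "\<forall>i. Suc i < min (dim_row ?D) (dim_col ?D) \<longrightarrow>
        (\<exists>r\<in>R. ?D $$ (Suc i, Suc i) = r * ?D $$ (i, i))"
      using d by auto
  qed (rule one_in_GL_R)+
  moreover have "map (\<lambda>i. absv (d i)) [0..<?m]
      = map (\<lambda>i. absv (?D $$ (i, i))) [0..<min (dim_row ?D) (dim_col ?D)]"
    using len by (auto simp: min_absorb2)
  ultimately show "\<exists>bs cs A D. R_basis absv s1 M bs \<and> R_basis absv s2 N cs \<and>
      matrix_of s2 T bs cs A \<and> smith_normal_form absv A D \<and>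
      map (\<lambda>i. absv (d i)) [0..<?m] = map (\<lambda>i. absv (D $$ (i, i))) [0..<min (dim_row D) (dim_col D)]"
    using bs cs by blast
next
  fix \<sigma>
  assume "\<exists>bs cs A D. R_basis absv s1 M bs \<and> R_basis absv s2 N cs \<and>
      matrix_of s2 T bs cs A \<and> smith_normal_form absv A D \<and>
      \<sigma> = map (\<lambda>i. absv (D $$ (i, i))) [0..<min (dim_row D) (dim_col D)]"
  then obtain bs1 cs1 A D where 1: "R_basis absv s1 M bs1" "R_basis absv s2 N cs1"
      "matrix_of s2 T bs1 cs1 A" and D: "smith_normal_form absv A D"
    and \<sigma>: "\<sigma> = map (\<lambda>i. absv (D $$ (i, i))) [0..<min (dim_row D) (dim_col D)]"
    by blast
  obtain bs' cs' where bs': "R_basis absv s1 M bs'" and cs': "R_basis absv s2 N cs'"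
    and dims: "length bs' = dim_col D" "length cs' = dim_row D"
      "dim_col D = length bs1" "dim_row D = length cs1"
    and TD: "\<And>j. j < length bs1 \<Longrightarrow>
      T (bs' ! j) = s2 (if j < length cs1 then D $$ (j, j) else 0) (cs' ! j)"
    using smith_normal_form_bases[OF vs1 vs2 T M N 1 D] by metis
  have len': "length bs' = length bs" "length cs' = length cs"
    using R_basis_length_le[OF vs1] R_basis_length_le[OF vs2] bs bs' cs cs' by (auto intro: order_antisym)
  define d' where "d' j = (if j < length cs' then D $$ (j, j) else 0)" for j
  have Tb': "\<And>j. j < length bs' \<Longrightarrow> T (bs' ! j) = s2 (d' j) (cs' ! j)"
    using TD dims by (simp add: d'_def)
  have "\<exists>r\<in>R. d' (Suc i) = r * d' i" if "Suc i < length bs'" for i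
    using D that len len' dims unfolding smith_normal_form_def by (simp add: d'_def)
  note dd' = divides_chain[of _ d', OF this]
  note dd = divides_chain[of _ d, OF d]
  have "absv (d i) = absv (D $$ (i, i))" if i: "i < length bs" for i
  proof (rule order_antisym)
    have ij: "i < length bs" "i < length cs" "i < length bs'" "i < length cs'"
      using i len len' by auto
    show "absv (d i) \<le> absv (D $$ (i, i))"
      using diagonal_absv_le[OF vs1 vs2 T N bs cs Tb dd bs' cs' Tb' dd' _ ij(1,2)] ij
      by (simp add: d'_def)
    \<comment> \<open>Beyond the end of \<open>cs\<close> the given \<open>d\<close> is arbitrary, whereas the comparison needs zeros.\<close>
    define d0 where "d0 j = (if j < length cs then d j else 0)" for j
    have "absv (d' i) \<le> absv (d0 i)"
    proof (rule diagonal_absv_le[OF vs1 vs2 T N bs' cs' Tb' dd' bs cs _ _ _ ij(3,4)])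
      show "\<exists>t\<in>R. d0 j = t * d0 i" if "i \<le> j" "j < length bs" for i j
        using dd[of "length bs" i j] that len by (simp add: d0_def)
    qed (use Tb len in \<open>auto simp: d0_def\<close>)
    then show "absv (D $$ (i, i)) \<le> absv (d i)"
      using ij by (simp add: d'_def d0_def)
  qed
  then show "\<sigma> = map (\<lambda>i. absv (d i)) [0..<length bs]"
    using \<sigma> dims len len' by (simp add: min_absorb2)
qed

end

section \<open>The position vector\<close>

context full_lattice
begin

sublocale prod: vector_space_prod scl scl
  by unfold_locales

lemma orthonormal_ex_coeff:
  assumes "orthonormal b I" "p \<in> span (b ` I)" "p \<in> M"
  shows "\<exists>c. (\<forall>i\<in>I. c i \<in> R) \<and> p = (\<Sum>i\<in>I. c i *s b i)"
proof -
  obtain c where c: "p = (\<Sum>i\<in>I. c i *s b i)"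
    using assms(2) unfolding span_family[OF orthonormal_finite[OF assms(1)]] by auto
  then have "\<forall>i\<in>I. c i \<in> R"
    using orthonormal_coeff[OF assms(1)] assms(3) by simp
  then show ?thesis
    using c by (intro exI[of _ c] conjI)
qed

text \<open>The vectors \<open>(u i, - e i)\<close> are chosen so that addition maps them to \<open>u i - e i\<close>, which for an adapted
  family is a multiple of a single basis vector. With \<open>(u i, 0)\<close> instead, the matrix of the
  addition map would not be diagonal.\<close>
lemma R_basis_product:
  assumes u: "orthonormal u {..<k}" "span (u ` {..<k}) = E"
    and e: "orthonormal e {..<l}" "span (e ` {..<l}) = F" and kl: "k \<le> l"
  shows "R_basis absv prod.scale ((E \<inter> M) \<times> (F \<inter> M))
    (map (\<lambda>j. (0, e j)) [0..<l] @ map (\<lambda>i. (u i, - e i)) [0..<k])"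
    (is "R_basis _ _ ?N ?bs")
proof -
  have uEM: "u i \<in> E \<inter> M" if "i < k" for i
    using u that orthonormal_in_M[OF u(1)] by (auto intro: span_base)
  have eFM: "e i \<in> F \<inter> M" if "i < l" for i
    using e that orthonormal_in_M[OF e(1)] by (auto intro: span_base)
  have subF: "subspace F" and subE: "subspace E"
    using u e by auto
  have sum: "(\<Sum>j<length ?bs. prod.scale (c j) (?bs ! j))
      = (\<Sum>i<k. c (l + i) *s u i, (\<Sum>j<l. c j *s e j) - (\<Sum>i<k. c (l + i) *s e i))" for c
  proof -
    have "(\<Sum>j<length ?bs. prod.scale (c j) (?bs ! j))
        = (\<Sum>j<l. prod.scale (c j) (0, e j)) + (\<Sum>i<k. prod.scale (c (l + i)) (u i, - e i))"
      by (simp add: sum_lessThan_add nth_append)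
    then show ?thesis
      by (simp add: prod_eq_iff fst_sum snd_sum prod.scale_prod sum_negf)
  qed
  show ?thesis
    unfolding R_basis_def
  proof (intro conjI ballI allI impI)
    show "set ?bs \<subseteq> ?N"
      using uEM eFM kl subspace_0[OF subE] subspace_neg[OF subF] M_minus by auto
  next
    fix w assume "w \<in> ?N"
    then obtain p q where w: "w = (p, q)" "p \<in> E" "p \<in> M" "q \<in> F" "q \<in> M"
      by auto
    from orthonormal_ex_coeff[OF u(1), of p] w u(2)
    obtain c where c: "\<forall>i\<in>{..<k}. c i \<in> R" "p = (\<Sum>i<k. c i *s u i)"
      by auto
    have "q + (\<Sum>i<k. c i *s e i) \<in> F"
      using w(4) eFM kl subF by (intro subspace_add subspace_sum subspace_scale) auto
    moreover have "q + (\<Sum>i<k. c i *s e i) \<in> M"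
      using w(5) eFM kl c(1) by (intro M_add M_sum M_scale) auto
    ultimately have "\<exists>d. (\<forall>j\<in>{..<l}. d j \<in> R) \<and> q + (\<Sum>i<k. c i *s e i) = (\<Sum>j<l. d j *s e j)"
      using e(2) by (intro orthonormal_ex_coeff[OF e(1)]) auto
    then obtain d where d: "\<forall>j\<in>{..<l}. d j \<in> R" "q + (\<Sum>i<k. c i *s e i) = (\<Sum>j<l. d j *s e j)"
      by (elim exE conjE)
    have "q = (\<Sum>j<l. d j *s e j) - (\<Sum>i<k. c i *s e i)"
      using d(2) by (simp add: eq_diff_eq)
    then have "w = (\<Sum>j<length ?bs. prod.scale (if j < l then d j else c (j - l)) (?bs ! j))"
      unfolding sum w(1) by (simp add: c(2))
    moreover have "\<forall>j<length ?bs. (if j < l then d j else c (j - l)) \<in> R"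
      using c(1) d(1) by auto
    ultimately show "\<exists>c. (\<forall>j<length ?bs. c j \<in> R) \<and> w = (\<Sum>j<length ?bs. prod.scale (c j) (?bs ! j))"
      by (intro exI[of _ "\<lambda>j. if j < l then d j else c (j - l)"] conjI)
  next
    fix c j assume c: "(\<Sum>j<length ?bs. prod.scale (c j) (?bs ! j)) = 0" and j: "j < length ?bs"
    have cu: "c (l + i) = 0" if "i < k" for i
      using c orthonormal_zero_coeff[OF u(1), of "\<lambda>i. c (l + i)"] that
      unfolding sum by (simp add: zero_prod_def)
    have "(\<Sum>j<l. c j *s e j) - (\<Sum>i<k. c (l + i) *s e i) = 0"
      using c unfolding sum by (simp add: zero_prod_def)
    then have "(\<Sum>j<l. c j *s e j) = 0"
      by (simp add: cu)
    then have ce: "c j = 0" if "j < l" for j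
      using orthonormal_zero_coeff[OF e(1)] that by simp
    show "c j = 0"
      using ce[of j] cu[of "j - l"] j by (cases "j < l") auto
  qed
qed

lemma R_submodule_product:
  assumes "subspace E" "subspace F"
  shows "R_submodule absv prod.scale ((E \<inter> M) \<times> (F \<inter> M))"
  using assms unfolding R_submodule_def
  by (auto simp: zero_prod_def prod.scale_prod subspace_0 subspace_add subspace_scale M_add M_scale)

lemma linear_add: "Vector_Spaces.linear prod.scale scl (\<lambda>(e, f). e + f)"
  by unfold_locales (auto simp: prod.scale_def scale_right_distrib)

lemma addition_singular_values_adapted:
  assumes b: "orthonormal b {..<n}" and dim: "dim (UNIV :: 'v set) = n" and kl: "k \<le> l" "l + k \<le> n"
    and F: "span (b ` {..<l}) = F"
    and u: "orthonormal (\<lambda>i. b i + epower \<pi> (x i) *s b (l + i)) {..<k}"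
    and E: "span ((\<lambda>i. b i + epower \<pi> (x i) *s b (l + i)) ` {..<k}) = E"
    and x: "\<And>i i'. i' < i \<Longrightarrow> i < k \<Longrightarrow> x i' \<le> x i"
  shows "addition_singular_values absv scl M E F
    = replicate l 1 @ map (\<lambda>i. epower (epsilon absv) (x i)) [0..<k]"
proof -
  let ?u = "\<lambda>i. b i + epower \<pi> (x i) *s b (l + i)"
  define bs where "bs = map (\<lambda>j. (0, b j)) [0..<l] @ map (\<lambda>i. (?u i, - b i)) [0..<k]"
  define d where "d j = (if j < l then 1 else epower \<pi> (x (j - l)))" for j
  have len: "length bs = l + k"
    by (simp add: bs_def)
  have "addition_singular_values absv scl M E F = map (\<lambda>i. absv (d i)) [0..<length bs]"
    unfolding addition_singular_values_def
  proof (rule singular_values_diagonal)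
    show "vector_space prod.scale"
      by (rule prod.p.vector_space_axioms)
    show "vector_space scl"
      by (rule vector_space_axioms)
    show "Vector_Spaces.linear prod.scale scl (\<lambda>(e, f). e + f)"
      by (rule linear_add)
    show "R_submodule absv prod.scale ((E \<inter> M) \<times> (F \<inter> M))"
      using E F by (intro R_submodule_product) auto
    show "R_submodule absv scl M"
      using linear_structure by (simp add: linear_R_structure_def)
    show "R_basis absv prod.scale ((E \<inter> M) \<times> (F \<inter> M)) bs"
      unfolding bs_def
      using kl by (intro R_basis_product u E orthonormal_subset[OF b] F) auto
    show "R_basis absv scl M (map b [0..<n])"
      using orthonormal_R_basis[OF b dim] .
    show "length bs \<le> length (map b [0..<n])"
      using kl len by simp
    show "(\<lambda>(e, f). e + f) (bs ! j) = d j *s (map b [0..<n] ! j)" if "j < length bs" for j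
      using that kl by (auto simp: bs_def d_def nth_append)
    show "\<exists>r\<in>R. d (Suc i) = r * d i" if i: "Suc i < length bs" for i
    proof (cases "i < l")
      case True
      then show ?thesis
        by (intro bexI[of _ "d (Suc i)"]) (auto simp: d_def)
    next
      case False
      then have "x (i - l) \<le> x (Suc i - l)"
        using i len by (intro x) auto
      then obtain r where "r \<in> R" "epower \<pi> (x (Suc i - l)) = r * epower \<pi> (x (i - l))"
        by (rule epower_mono)
      then show ?thesis
        using False by (intro bexI[of _ r]) (auto simp: d_def)
    qed
  qed
  also have "\<dots> = replicate l 1 @ map (\<lambda>i. epower (epsilon absv) (x i)) [0..<k]"
    by (rule nth_equalityI) (auto simp: len d_def nth_append absv_epower)
  finally show ?thesis .
qed

end

lemma linear_R_structure_full_lattice: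
  assumes "nonarch_local_field absv \<pi>" "vector_space scl" "linear_R_structure absv scl M"
  shows "\<exists>Basis. full_lattice absv \<pi> scl Basis M"
proof -
  interpret nonarch_local_field absv \<pi> by fact
  interpret vector_space scl by fact
  obtain S where S: "finite S" "\<forall>x\<in>M. \<exists>c. (\<forall>s\<in>S. c s \<in> R) \<and> x = (\<Sum>s\<in>S. scl (c s) s)"
    using assms(3) unfolding linear_R_structure_def R_finitely_generated_def by blast
  have "M \<subseteq> span S"
  proof
    fix x assume "x \<in> M"
    then obtain c where "x = (\<Sum>s\<in>S. scl (c s) s)"
      using S(2) by auto
    then show "x \<in> span S"
      by (auto intro: span_sum span_scale span_base)
  qed
  then have "span S = UNIV"
    using assms(3) span_minimal[of M "span S"] by (auto simp: linear_R_structure_def)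
  moreover obtain B where B: "B \<subseteq> S" "independent B" "S \<subseteq> span B"
    using maximal_independent_subset[of S] by blast
  ultimately have "span B = UNIV"
    using span_minimal[of S "span B"] by auto
  then have "full_lattice absv \<pi> scl B M"
    using B S(1) assms(3) finite_subset by unfold_locales auto
  then show ?thesis ..
qed

theorem theorem4p2p5:
  fixes absv :: "'k::field_char_0 \<Rightarrow> real" and \<pi> :: 'k
    and scl :: "'k \<Rightarrow> 'v::ab_group_add \<Rightarrow> 'v"
    and V_R E F :: "'v set" and n k l :: nat
  assumes "nonarch_local_field absv \<pi>"
    and "vector_space scl"
    and "vector_space.dim scl (UNIV :: 'v set) = n"
    and "linear_R_structure absv scl V_R"
    and "module.subspace scl E" and "vector_space.dim scl E = k"
    and "module.subspace scl F" and "vector_space.dim scl F = l"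
    and "k \<le> l" and "k + l \<le> n"
  shows "\<exists>xs :: enat list. \<exists>es fs gs :: 'v list.
    length xs = k \<and> sorted xs \<and>
    length es = l \<and> length fs = k \<and> length gs = n - k - l \<and>
    R_basis absv scl V_R (es @ fs @ gs) \<and>
    F = module.span scl (set es) \<and>
    E = module.span scl {es ! i + scl (epower \<pi> (xs ! i)) (fs ! i) | i. i < k} \<and>
    position_vector absv scl V_R E F xs"
proof -
  obtain Basis where "full_lattice absv \<pi> scl Basis V_R"
    using linear_R_structure_full_lattice assms by blast
  then interpret full_lattice absv \<pi> scl Basis V_R .
  have kl: "l + k \<le> n"
    using assms(10) by simp
  obtain b x where b: "orthonormal b {..<n}" and F: "span (b ` {..<l}) = F"
    and u: "orthonormal (\<lambda>i. b i + scl (epower \<pi> (x i)) (b (l + i))) {..<k}"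
    and E: "span ((\<lambda>i. b i + scl (epower \<pi> (x i)) (b (l + i))) ` {..<k}) = E"
    and x: "\<And>i i'. i' < i \<Longrightarrow> i < k \<Longrightarrow> x i' \<le> (x i :: enat)"
  proof (rule ex_adapted_family[OF assms(5,6,7,8,9) kl assms(3)])
    fix b x
    assume "orthonormal b {..<n}" "span (b ` {..<l}) = F"
      "orthonormal (\<lambda>i. b i + scl (epower \<pi> (x i)) (b (l + i))) {..<k}"
      "span ((\<lambda>i. b i + scl (epower \<pi> (x i)) (b (l + i))) ` {..<k}) = E"
      "\<And>i i'. i' < i \<Longrightarrow> i < k \<Longrightarrow> x i' \<le> (x i :: enat)"
    then show thesis
      by (rule that)
  qed
  define xs where "xs = map x [0..<k]"
  define es where "es = map b [0..<l]"
  define fs where "fs = map (\<lambda>i. b (l + i)) [0..<k]"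
  define gs where "gs = map b [l + k..<n]"
  have "map b [0..<n] = es @ fs @ gs"
    using kl by (intro nth_equalityI) (auto simp: es_def fs_def gs_def nth_append)
  then have basis: "R_basis absv scl V_R (es @ fs @ gs)"
    using orthonormal_R_basis[OF b assms(3)] by simp
  have sorted: "sorted xs"
    using x by (auto simp: sorted_iff_nth_mono_less xs_def)
  have F_es: "F = span (set es)"
    using F by (simp add: es_def atLeast0LessThan)
  have "{es ! i + scl (epower \<pi> (xs ! i)) (fs ! i) | i. i < k}
      = (\<lambda>i. b i + scl (epower \<pi> (x i)) (b (l + i))) ` {..<k}"
    using assms(9) by (force simp: es_def fs_def xs_def)
  then have E_es: "E = span {es ! i + scl (epower \<pi> (xs ! i)) (fs ! i) | i. i < k}"
    using E by simp
  have "position_vector absv scl V_R E F xs"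
    unfolding position_vector_def
    using addition_singular_values_adapted[OF b assms(3,9) kl F u E x] sorted assms(6,8)
    by (simp add: xs_def comp_def)
  then show ?thesis
    using basis sorted F_es E_es
    by (intro exI[of _ xs] exI[of _ es] exI[of _ fs] exI[of _ gs])
      (simp add: xs_def es_def fs_def gs_def)
qed

end
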